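(* Let $\boldsymbol{u}^{e}(t_n)$ be the exact solution, at time $t_n$, of $$\boldsymbol{u}_t(\boldsymbol{x},t)=\mathcal{N}(\boldsymbol{u}(\boldsymbol{x},t))=\mathcal{L}(\boldsymbol{u})+\mathcal{G}(\boldsymbol{u}),\quad t\in(0,T],\qquad \boldsymbol{u}(\boldsymbol{x},0)=\boldsymbol{u}^0(\boldsymbol{x}),$$ with values in $\mathbb{R}^{d_u}$, where $\mathcal{L}$ is the stiff linear part and $\mathcal{G}$ the nonlinear part of $\mathcal{N}$. Let $\boldsymbol{u}^{n}$ be the solution generated by the four-stage IMEX Runge--Kutta scheme described in the context, written in the increment form $$\boldsymbol{u}^{n+1}=\boldsymbol{u}^{n}+\Delta t\,H_{\mathrm{IMEX}}(\boldsymbol{x},t_n,\boldsymbol{u}^{n}(\boldsymbol{x}),\Delta t).$$ Let $\widetilde{\boldsymbol{u}}^{n}$ and $\widehat{\boldsymbol{u}}^{n}$ be the optimal and numerical random feature method (RFM) solutions, respectively, obtained through the RFM representation of the stages and the associated least-squares systems (see context). Assume that $\widehat{\boldsymbol{u}}^{0}=\boldsymbol{u}^{e}(t_0)$. Assume that the increment map $H_{\mathrm{IMEX}}$ is Lipschitz continuous with respect to the numerical state, that is, there exists a constant $L>0$ such that $$\|H_{\mathrm{IMEX}}(\boldsymbol{x},t_n,\boldsymbol{u}^{n}(\boldsymbol{x}),\Delta t)-H_{\mathrm{IMEX}}(\boldsymbol{x},t_n,\boldsymbol{u}^{e}(t_n,\boldsymbol{x}),\Delta t)\|_{L^2}\le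 L\|\boldsymbol{u}^{n}(\boldsymbol{x})-\boldsymbol{u}^{e}(t_n,\boldsymbol{x})\|_{L^2}$$ for all $n=0,\dots,K$. Next, assume that the optimal RFM stage approximation satisfies $$\|\widetilde{\boldsymbol{u}}^{n}(\boldsymbol{x})-\boldsymbol{u}^{n}(\boldsymbol{x})\|_{L^2}\le\sqrt{d_u}\,\epsilon,\qquad n=0,\dots,K,$$ for a given $\epsilon>0$. (This bound follows from the universal approximation property recalled in the context, where $\epsilon$ depends on $N=MJ_n$ and the regularity of $\boldsymbol{u}^n$.) Finally, assume that the IMEX tableau used in the scheme has temporal order $p_t$, so that the local truncation error satisfies $$\|\boldsymbol{u}^{e}(t_{n+1},\boldsymbol{x})-\boldsymbol{u}^{e}(t_n,\boldsymbol{x})-\Delta t\,H_{\mathrm{IMEX}}(\boldsymbol{x},t_n,\boldsymbol{u}^{e}(t_n,\boldsymbol{x}),\Delta t)\|_{L^2}\le C\Delta t^{p_t+1}.$$ Then there exist constants $C_2,C_3>0$ such that $$E_{\delta u}\left[\|\widehat{\boldsymbol{u}}^{n}(\boldsymbol{x})-\boldsymbol{u}^{e}(t_n,\boldsymbol{x})\|_{L^2}\right]\le C_2\sqrt{d_uMJ_n}\,\delta+\sqrt{d_u}\,\epsilon+C_3\Delta t^{p_t},\qquad n=0,\dots,K,$$ where $M$, $J_n$, $\delta$ and $E_{\delta u}$ are as in the context.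
   Context: **Setting.** $\Omega\subset\mathbb{R}^d$ is a bounded, connected domain; $L^2$ norms are over $\Omega$ (for $\mathbb{R}^{d_u}$-valued functions). $T$ is the terminal time, $K$ the number of time steps, $\Delta t$ the time step, and $t_n=n\Delta t$. **IMEX scheme.** With IMEX Runge--Kutta coefficients (Butcher tableau) $a_{ij},\hat a_{ij},b_i,\hat b_i$, one step from $\boldsymbol{u}^n$ computes the stages $U_1,U_2,U_3,U_4$ successively from $$(I-\Delta t\,a_{ii}\mathcal{L})U_i=\boldsymbol{u}^n+\Delta t\sum_{j=1}^{i-1}a_{ij}\mathcal{L}(U_j)+\Delta t\sum_{j=1}^{i-1}\hat a_{ij}\mathcal{G}(U_j),\qquad i=1,\dots,4,$$ and then $$\boldsymbol{u}^{n+1}=\boldsymbol{u}^n+\Delta t\sum_{i=1}^4 b_i\mathcal{L}(U_i)+\Delta t\sum_{i=1}^4\hat b_i\mathcal{G}(U_i).$$ $H_{\mathrm{IMEX}}$ is the resulting increment map. **RFM trial functions.** A hyper-rectangle containing $\Omega$ is partitioned into $M$ non-overlapping hyper-rectangles $\Omega_1,\dots,\Omega_M$ with centers $\boldsymbol{c}^{(m)}$ and half-widths $\boldsymbol{r}^{(m)}$, and $\widetilde{\boldsymbol{x}}^{(m)}=(\boldsymbol{x}-\boldsymbol{c}^{(m)})/\boldsymbol{r}^{(m)}$ (componentwise). On each $\Omega_m$ there are $J_n\in\mathbb{N}^+$ random features (the subscript in $J_n$ is not the time index) $\phi_j^{(m)}(\boldsymbol{x})=\sigma(\boldsymbol{k}_j^{(m)}\cdot\widetilde{\boldsymbol{x}}^{(m)}+b_j^{(m)})$,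 where $\sigma$ is a nonlinear scalar activation function (typically $\tanh$ or trigonometric), and the components of $\boldsymbol{k}_j^{(m)}\in\mathbb{R}^d$ and $b_j^{(m)}\in\mathbb{R}$ are sampled independently from the uniform distribution on $[-R_m,R_m]$ ($R_m>0$ a fixed parameter) and then kept fixed. $\psi$ is a partition-of-unity function on the reference cube, a tensor product $\psi(\boldsymbol{x})=\prod_i\psi(x_i)$ of a one-dimensional function, two commonly used choices being $\psi_{\rm a}(x)=\mathbb{I}_{[-1,1]}(x)$ and $\psi_{\rm b}(x)=\mathbb{I}_{[-5/4,-3/4]}(x)\frac{1+\tanh(2\pi x)}{2}+\mathbb{I}_{[-3/4,3/4]}(x)+\mathbb{I}_{[3/4,5/4]}(x)\frac{1-\tanh(2\pi x)}{2}$, with $\mathbb{I}$ the characteristic function. A scalar RFM function is $$\sum_{m=1}^M\psi(\widetilde{\boldsymbol{x}}^{(m)})\sum_{j=1}^{J_n}\omega_{mj}\phi_j^{(m)}(\boldsymbol{x}),\qquad \omega_{mj}\in\mathbb{R},$$ with $N=MJ_n$ degrees of freedom; an $\mathbb{R}^{d_u}$-valued RFM function has each of its $d_u$ components of this form. **Optimal and numerical RFM solutions.** Each stage solution is represented by an RFM function; collocation of the stage equation gives a linear least-squares system $A_i^{(n)}w_i^{(n)}=f_i^{(n)}$, $i=1,\dots,4$, for the vector $w_i^{(n)}$ of stage coefficients, which in practice is computed by the truncated-SVD pseudoinverse $w_i^{(n)}=(A_i^{(n)})^{\dagger}_{\tau_s}f_i^{(n)}$ with singular-value cutoff $\tau_s$.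 The optimal solution $\widetilde{\boldsymbol{u}}^n$ corresponds to the optimal (loss-minimizing) coefficient vector $\widetilde U$, and the numerical solution $\widehat{\boldsymbol{u}}^n$ to the numerical coefficient vector $\widehat U$. **Coefficient perturbation model.** On each subdomain (and for each solution component), the difference $\delta U$ between the numerical and the optimal coefficient vectors is written $\delta U=\sum_{j=1}^{J_n}\delta u_j\beta_j$, where $\{\beta_j\}_{j=1}^{J_n}$ is an orthonormal basis of $\mathbb{R}^{J_n}$ and $\delta u_j$, $j=1,\dots,J_n$, are independent and identically distributed random variables with $$E[\delta u_j]=0,\qquad E[|\delta u_j|]=\mu>0,\qquad E[\delta u_j^2]=\delta^2>0.$$ $E_{\delta u}$ denotes expectation with respect to these variables. **Universal approximation property referred to in the claim.** If $\sigma$ is bounded, nonconstant and piecewise continuous, and $G_N$ denotes scalar RFM functions with $N=MJ_n$ degrees of freedom, then for any $f\in C(\Omega)$ there exists a sequence of coefficient vectors such that $\lim_{N\to\infty}\|G_N-f\|_{L^2(\Omega)}=0$. *)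

theory Defs
  imports "HOL-Analysis.Analysis" "HOL-Probability.Probability"
begin

type_synonym ('d, 'u) field = "real ^ 'd \<Rightarrow> real ^ 'u"

text \<open>A field on \<open>\<Omega>\<close> is represented by a total function of which only the values on \<open>\<Omega>\<close>
  are used. The Bochner integral of a non-integrable function is 0, so \<open>L2_norm\<close> is the
  \<open>L\<^sup>2(\<Omega>)\<close> norm only together with \<open>in_L2\<close>.\<close>

definition in_L2 :: "(real ^ 'd) set \<Rightarrow> ('d::finite, 'u::finite) field \<Rightarrow> bool" where
  "in_L2 \<Omega> f \<longleftrightarrow> f \<in> borel_measurable (lebesgue_on \<Omega>) \<and>
     integrable (lebesgue_on \<Omega>) (\<lambda>x. (norm (f x))\<^sup>2)"

definition L2_norm :: "(real ^ 'd) set \<Rightarrow> ('d::finite, 'u::finite) field \<Rightarrow> real" where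
  "L2_norm \<Omega> f = sqrt (integral\<^sup>L (lebesgue_on \<Omega>) (\<lambda>x. (norm (f x))\<^sup>2))"


subsection \<open>The evolution equation\<close>

definition operator_on :: "(real ^ 'd) set \<Rightarrow>
    (('d::finite, 'u::finite) field \<Rightarrow> ('d, 'u) field) \<Rightarrow> bool" where
  "operator_on \<Omega> F \<longleftrightarrow>
     (\<forall>v w. (\<forall>x\<in>\<Omega>. v x = w x) \<longrightarrow> (\<forall>x\<in>\<Omega>. F v x = F w x))"

text \<open>An unbounded linear operator, defined on a linear subspace of the functions on \<open>\<Omega>\<close>, is
  represented by an arbitrary linear extension to all functions; such an extension always
  exists and only its values on the functions to which it is applied matter.\<close>

definition linear_operator_on :: "(real ^ 'd) set \<Rightarrow>
    (('d::finite, 'u::finite) field \<Rightarrow> ('d, 'u) field) \<Rightarrow> bool" where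
  "linear_operator_on \<Omega> F \<longleftrightarrow> operator_on \<Omega> F \<and>
     (\<forall>v w. \<forall>x\<in>\<Omega>. F (\<lambda>y. v y + w y) x = F v x + F w x) \<and>
     (\<forall>c v. \<forall>x\<in>\<Omega>. F (\<lambda>y. c *\<^sub>R v y) x = c *\<^sub>R F v x)"

definition exact_solution :: "(real ^ 'd) set \<Rightarrow> real \<Rightarrow>
    (('d::finite, 'u::finite) field \<Rightarrow> ('d, 'u) field) \<Rightarrow>
    (('d, 'u) field \<Rightarrow> ('d, 'u) field) \<Rightarrow> ('d, 'u) field \<Rightarrow> (real \<Rightarrow> ('d, 'u) field) \<Rightarrow> bool" where
  "exact_solution \<Omega> T Lop Gop u0 ue \<longleftrightarrow>
     (\<forall>x\<in>\<Omega>. ue 0 x = u0 x \<and> continuous_on {0..T} (\<lambda>t. ue t x) \<and>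
       (\<forall>t\<in>{0<..T}. ((\<lambda>s. ue s x) has_vector_derivative (Lop (ue t) x + Gop (ue t) x))
                       (at t within {0..T})))"


subsection \<open>The four-stage IMEX Runge--Kutta scheme\<close>

text \<open>Butcher coefficients \<open>a\<^sub>i\<^sub>j, b\<^sub>i\<close> (implicit part) and their hatted counterparts
  (explicit part); the indices range over 1, 2, 3, 4.\<close>

record imex_tableau =
  im_a :: "nat \<Rightarrow> nat \<Rightarrow> real"
  im_b :: "nat \<Rightarrow> real"
  ex_a :: "nat \<Rightarrow> nat \<Rightarrow> real"
  ex_b :: "nat \<Rightarrow> real"

definition stage_rhs :: "imex_tableau \<Rightarrow> real \<Rightarrow>
    (('d::finite, 'u::finite) field \<Rightarrow> ('d, 'u) field) \<Rightarrow> (('d, 'u) field \<Rightarrow> ('d, 'u) field) \<Rightarrow>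
    ('d, 'u) field \<Rightarrow> (nat \<Rightarrow> ('d, 'u) field) \<Rightarrow> nat \<Rightarrow> ('d, 'u) field" where
  "stage_rhs tab dt Lop Gop v U i x =
     v x + dt *\<^sub>R (\<Sum>j = 1..<i. im_a tab i j *\<^sub>R Lop (U j) x)
         + dt *\<^sub>R (\<Sum>j = 1..<i. ex_a tab i j *\<^sub>R Gop (U j) x)"

definition imex_stages :: "(real ^ 'd) set \<Rightarrow> imex_tableau \<Rightarrow> real \<Rightarrow>
    (('d::finite, 'u::finite) field \<Rightarrow> ('d, 'u) field) \<Rightarrow> (('d, 'u) field \<Rightarrow> ('d, 'u) field) \<Rightarrow>
    ('d, 'u) field \<Rightarrow> (nat \<Rightarrow> ('d, 'u) field) \<Rightarrow> bool" where
  "imex_stages \<Omega> tab dt Lop Gop v U \<longleftrightarrow>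
     (\<forall>i\<in>{1..4}. \<forall>x\<in>\<Omega>.
        U i x - (dt * im_a tab i i) *\<^sub>R Lop (U i) x = stage_rhs tab dt Lop Gop v U i x)"

definition stage_increment :: "imex_tableau \<Rightarrow>
    (('d::finite, 'u::finite) field \<Rightarrow> ('d, 'u) field) \<Rightarrow> (('d, 'u) field \<Rightarrow> ('d, 'u) field) \<Rightarrow>
    (nat \<Rightarrow> ('d, 'u) field) \<Rightarrow> ('d, 'u) field" where
  "stage_increment tab Lop Gop U x =
     (\<Sum>i = 1..4. im_b tab i *\<^sub>R Lop (U i) x) + (\<Sum>i = 1..4. ex_b tab i *\<^sub>R Gop (U i) x)"

text \<open>\<open>h\<close> is the value at the state \<open>v\<close> of the increment map of the scheme. Stage equations may
  have several solutions when \<open>Lop\<close> does not encode boundary conditions; the increment is then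
  the one of the stages that the scheme selects.\<close>

definition imex_increment :: "(real ^ 'd) set \<Rightarrow> imex_tableau \<Rightarrow> real \<Rightarrow>
    (('d::finite, 'u::finite) field \<Rightarrow> ('d, 'u) field) \<Rightarrow> (('d, 'u) field \<Rightarrow> ('d, 'u) field) \<Rightarrow>
    ('d, 'u) field \<Rightarrow> ('d, 'u) field \<Rightarrow> bool" where
  "imex_increment \<Omega> tab dt Lop Gop v h \<longleftrightarrow>
     (\<exists>U. imex_stages \<Omega> tab dt Lop Gop v U \<and>
          (\<forall>x\<in>\<Omega>. h x = stage_increment tab Lop Gop U x))"

text \<open>In this case the fourth stage is the new state.\<close>

definition stiffly_accurate :: "imex_tableau \<Rightarrow> bool" where
  "stiffly_accurate tab \<longleftrightarrow> (\<forall>j\<in>{1..4}. im_b tab j = im_a tab 4 j) \<and>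
     (\<forall>j\<in>{1..3}. ex_b tab j = ex_a tab 4 j) \<and> ex_b tab 4 = 0"


subsection \<open>Random feature functions\<close>

definition piecewise_continuous :: "(real \<Rightarrow> real) \<Rightarrow> bool" where
  "piecewise_continuous f \<longleftrightarrow>
     (\<exists>S. (\<forall>a b. finite (S \<inter> {a..b})) \<and> (\<forall>x. x \<notin> S \<longrightarrow> isCont f x) \<and>
          (\<forall>x\<in>S. (\<exists>l. (f \<longlongrightarrow> l) (at_left x)) \<and> (\<exists>r. (f \<longlongrightarrow> r) (at_right x))))"

text \<open>Nonlinear means not affine. Bounded nonconstant piecewise continuous functions are
  included, and so are unbounded activations.\<close>

definition activation :: "(real \<Rightarrow> real) \<Rightarrow> bool" where
  "activation \<sigma> \<longleftrightarrow> piecewise_continuous \<sigma> \<and> (\<nexists>a b. \<forall>x. \<sigma> x = a * x + b)"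

text \<open>The one-dimensional factor of the partition-of-unity function. The identity that the
  translates sum up to 1 is not required; \<open>psi_b\<close> below does not satisfy it exactly.\<close>

definition pou_profile :: "(real \<Rightarrow> real) \<Rightarrow> bool" where
  "pou_profile \<psi> \<longleftrightarrow> piecewise_continuous \<psi> \<and> (\<exists>\<rho>. \<forall>x. \<bar>x\<bar> > \<rho> \<longrightarrow> \<psi> x = 0)"

definition psi_a :: "real \<Rightarrow> real" where
  "psi_a = indicator {-1..1}"

definition psi_b :: "real \<Rightarrow> real" where
  "psi_b x = indicator {-5/4..-3/4} x * ((1 + tanh (2 * pi * x)) / 2)
           + indicator {-3/4..3/4} x
           + indicator {3/4..5/4} x * ((1 - tanh (2 * pi * x)) / 2)"

lemma piecewise_continuous_isCont:
  assumes "\<And>x. isCont f x" shows "piecewise_continuous f"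
  unfolding piecewise_continuous_def using assms by (intro exI[of _ "{}"]) auto

lemma piecewise_continuous_one_sided:
  assumes "piecewise_continuous f"
  shows "(\<exists>l. (f \<longlongrightarrow> l) (at_left x)) \<and> (\<exists>r. (f \<longlongrightarrow> r) (at_right x))"
proof (cases "isCont f x")
  case True
  then show ?thesis unfolding isCont_def filterlim_at_split by blast
next
  case False
  then show ?thesis using assms unfolding piecewise_continuous_def by blast
qed

lemma piecewise_continuous_indicator: "piecewise_continuous (indicator {a..b::real})"
proof -
  have 1: "isCont (indicator {a..b} :: real \<Rightarrow> real) x" if "x \<notin> {a, b}" for x
  proof -
    have "x \<notin> frontier {a..b}" using that frontier_cbox[of a b] by (auto split: if_splits)
    then show ?thesis by (simp add: isCont_indicator)
  qed
  have 2: "\<exists>l. ((indicator {a..b} :: real \<Rightarrow> real) \<longlongrightarrow> l) (at_left x)" for x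
  proof -
    have "eventually (\<lambda>y. indicator {a..b} y = (if a < x \<and> x \<le> b then 1 else 0 :: real)) (at_left x)"
    proof -
      consider "x \<le> a" | "a < x" "x \<le> b" | "a < x" "b < x" by linarith
      then show ?thesis
      proof cases
        case 1
          then show ?thesis
            by (intro eventually_mono[OF eventually_at_left_real[of "x - 1" x]]) (simp_all add: indicator_def)
      next
        case 2
          then show ?thesis
            by (intro eventually_mono[OF eventually_at_left_real[of a x]]) (simp_all add: indicator_def)
      next
        case 3
          then show ?thesis
            by (intro eventually_mono[OF eventually_at_left_real[of b x]]) (simp_all add: indicator_def)
      qed
    qed
    then show ?thesis by (blast intro: tendsto_eventually)
  qed
  have 3: "\<exists>l. ((indicator {a..b} :: real \<Rightarrow> real) \<longlongrightarrow> l) (at_right x)" for x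
  proof -
    have "eventually (\<lambda>y. indicator {a..b} y = (if a \<le> x \<and> x < b then 1 else 0 :: real)) (at_right x)"
    proof -
      consider "b \<le> x" | "a \<le> x" "x < b" | "x < a" "x < b" by linarith
      then show ?thesis
      proof cases
        case 1
          then show ?thesis
            by (intro eventually_mono[OF eventually_at_right_real[of x "x + 1"]]) (simp_all add: indicator_def)
      next
        case 2
          then show ?thesis
            by (intro eventually_mono[OF eventually_at_right_real[of x b]]) (simp_all add: indicator_def)
      next
        case 3
          then show ?thesis
            by (intro eventually_mono[OF eventually_at_right_real[of x a]]) (simp_all add: indicator_def)
      qed
    qed
    then show ?thesis by (blast intro: tendsto_eventually)
  qed
  show ?thesis
    unfolding piecewise_continuous_def using 1 2 3 by (intro exI[of _ "{a, b}"]) auto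
qed

lemma piecewise_continuous_combine:
  assumes f: "piecewise_continuous f" and g: "piecewise_continuous g"
  shows "piecewise_continuous (\<lambda>x. f x + g x)" "piecewise_continuous (\<lambda>x. f x * g x)"
proof -
  obtain S where S: "\<And>a b. finite (S \<inter> {a..b})" "\<And>x. x \<notin> S \<Longrightarrow> isCont f x"
    using f unfolding piecewise_continuous_def by auto
  obtain S' where S': "\<And>a b. finite (S' \<inter> {a..b})" "\<And>x. x \<notin> S' \<Longrightarrow> isCont g x"
    using g unfolding piecewise_continuous_def by auto
  have fin: "finite ((S \<union> S') \<inter> {a..b})" for a b
    using S(1) S'(1) by (simp add: Int_Un_distrib2)
  have lim: "(\<exists>l. ((\<lambda>x. f x + g x) \<longlongrightarrow> l) (at_left x)) \<and> (\<exists>r. ((\<lambda>x. f x + g x) \<longlongrightarrow> r) (at_right x))"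
    "(\<exists>l. ((\<lambda>x. f x * g x) \<longlongrightarrow> l) (at_left x)) \<and> (\<exists>r. ((\<lambda>x. f x * g x) \<longlongrightarrow> r) (at_right x))" for x
    using piecewise_continuous_one_sided[OF f, of x] piecewise_continuous_one_sided[OF g, of x]
    by (blast intro: tendsto_add tendsto_mult)+
  show "piecewise_continuous (\<lambda>x. f x + g x)"
    unfolding piecewise_continuous_def using fin S(2) S'(2) lim(1)
    by (intro exI[of _ "S \<union> S'"]) simp
  show "piecewise_continuous (\<lambda>x. f x * g x)"
    unfolding piecewise_continuous_def using fin S(2) S'(2) lim(2)
    by (intro exI[of _ "S \<union> S'"]) simp
qed

lemma pou_profile_psi_a: "pou_profile psi_a"
  unfolding pou_profile_def psi_a_def
  by (auto intro!: piecewise_continuous_indicator exI[of _ 1] simp: indicator_def)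

lemma pou_profile_psi_b: "pou_profile psi_b"
proof -
  have t: "isCont (\<lambda>x::real. tanh (2 * pi * x)) x" for x
    by (rule continuous_tanh) (auto intro!: continuous_intros simp: cosh_real_nonzero)
  have p: "piecewise_continuous (\<lambda>x. (1 + tanh (2 * pi * x)) / 2)"
    by (rule piecewise_continuous_isCont, rule isCont_divide, rule isCont_add) (simp_all add: t)
  have m: "piecewise_continuous (\<lambda>x. (1 - tanh (2 * pi * x)) / 2)"
    by (rule piecewise_continuous_isCont, rule isCont_divide, rule isCont_diff) (simp_all add: t)
  note c = piecewise_continuous_combine and i = piecewise_continuous_indicator
  have "piecewise_continuous psi_b"
    using c(1)[OF c(1)[OF c(2)[OF i p] i] c(2)[OF i m]]
    unfolding psi_b_def[abs_def] .
  moreover have "\<forall>x. \<bar>x\<bar> > 5/4 \<longrightarrow> psi_b x = 0"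
    by (auto simp: psi_b_def indicator_def)
  ultimately show ?thesis unfolding pou_profile_def by blast
qed

text \<open>\<open>M\<close> subdomains with centres and half-widths, and \<open>J\<close> features on each of them; subdomain
  and feature indices start at 0.\<close>

record 'd rfm_space =
  rfm_M :: nat
  rfm_J :: nat
  rfm_center :: "nat \<Rightarrow> real ^ 'd"
  rfm_halfwidth :: "nat \<Rightarrow> real ^ 'd"
  rfm_weight :: "nat \<Rightarrow> nat \<Rightarrow> real ^ 'd"
  rfm_bias :: "nat \<Rightarrow> nat \<Rightarrow> real"

definition subdomain :: "'d rfm_space \<Rightarrow> nat \<Rightarrow> (real ^ 'd::finite) set" where
  "subdomain S m = cbox (rfm_center S m - rfm_halfwidth S m) (rfm_center S m + rfm_halfwidth S m)"

definition rescale :: "'d rfm_space \<Rightarrow> nat \<Rightarrow> real ^ 'd \<Rightarrow> real ^ 'd::finite" where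
  "rescale S m x = (\<chi> i. (x $ i - rfm_center S m $ i) / rfm_halfwidth S m $ i)"

text \<open>The parameters of the features are fixed samples from \<open>[-R, R]\<close>. Every possible outcome of
  the sampling is admitted.\<close>

definition rfm_space_on :: "(real ^ 'd) set \<Rightarrow> real \<Rightarrow> ('d::finite) rfm_space \<Rightarrow> bool" where
  "rfm_space_on B R S \<longleftrightarrow> rfm_M S \<ge> 1 \<and> rfm_J S \<ge> 1 \<and>
     (\<forall>m<rfm_M S. \<forall>i. rfm_halfwidth S m $ i > 0) \<and>
     (\<Union>m<rfm_M S. subdomain S m) = B \<and>
     (\<forall>m<rfm_M S. \<forall>m'<rfm_M S. m \<noteq> m' \<longrightarrow>
        interior (subdomain S m) \<inter> interior (subdomain S m') = {}) \<and>
     (\<forall>m<rfm_M S. \<forall>j<rfm_J S.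
        (\<forall>i. \<bar>rfm_weight S m j $ i\<bar> \<le> R) \<and> \<bar>rfm_bias S m j\<bar> \<le> R)"

definition rfm_basis :: "(real \<Rightarrow> real) \<Rightarrow> (real \<Rightarrow> real) \<Rightarrow> ('d::finite) rfm_space \<Rightarrow>
    nat \<Rightarrow> nat \<Rightarrow> real ^ 'd \<Rightarrow> real" where
  "rfm_basis \<sigma> \<psi> S m j x = (\<Prod>i\<in>UNIV. \<psi> (rescale S m x $ i)) *
     \<sigma> (rfm_weight S m j \<bullet> rescale S m x + rfm_bias S m j)"

text \<open>Coefficients: solution component, subdomain, feature.\<close>

type_synonym 'u coefs = "'u \<Rightarrow> nat \<Rightarrow> nat \<Rightarrow> real"

definition rfm_fun :: "(real \<Rightarrow> real) \<Rightarrow> (real \<Rightarrow> real) \<Rightarrow> ('d::finite) rfm_space \<Rightarrow>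
    'u coefs \<Rightarrow> ('d, 'u::finite) field" where
  "rfm_fun \<sigma> \<psi> S w x =
     (\<chi> k. \<Sum>m<rfm_M S. \<Sum>j<rfm_J S. w k m j * rfm_basis \<sigma> \<psi> S m j x)"


subsection \<open>Collocation and the optimal solution\<close>

text \<open>Entry of the least-squares matrix of the equation \<open>(I - \<alpha> Lop) U = f\<close> in the row of
  component \<open>k\<close> at the collocation point \<open>x\<close> and in the column of the coefficient \<open>(k', m, j)\<close>.\<close>

definition colloc_matrix :: "(real \<Rightarrow> real) \<Rightarrow> (real \<Rightarrow> real) \<Rightarrow> ('d::finite) rfm_space \<Rightarrow>
    (('d, 'u::finite) field \<Rightarrow> ('d, 'u) field) \<Rightarrow> real \<Rightarrow>
    real ^ 'd \<Rightarrow> 'u \<Rightarrow> 'u \<Rightarrow> nat \<Rightarrow> nat \<Rightarrow> real" where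
  "colloc_matrix \<sigma> \<psi> S Lop \<alpha> x k k' m j =
     (let e = (\<lambda>y. rfm_basis \<sigma> \<psi> S m j y *\<^sub>R axis k' 1) in (e x - \<alpha> *\<^sub>R Lop e x) $ k)"

definition ls_loss :: "(real ^ 'd) set \<Rightarrow> ('d::finite) rfm_space \<Rightarrow>
    (real ^ 'd \<Rightarrow> 'u \<Rightarrow> 'u \<Rightarrow> nat \<Rightarrow> nat \<Rightarrow> real) \<Rightarrow> ('d, 'u::finite) field \<Rightarrow> 'u coefs \<Rightarrow> real" where
  "ls_loss Q S A f w = (\<Sum>x\<in>Q. \<Sum>k\<in>UNIV.
     ((\<Sum>k'\<in>UNIV. \<Sum>m<rfm_M S. \<Sum>j<rfm_J S. A x k k' m j * w k' m j) - f x $ k)\<^sup>2)"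

definition ls_optimal :: "(real ^ 'd) set \<Rightarrow> ('d::finite) rfm_space \<Rightarrow>
    (real ^ 'd \<Rightarrow> 'u \<Rightarrow> 'u \<Rightarrow> nat \<Rightarrow> nat \<Rightarrow> real) \<Rightarrow> ('d, 'u::finite) field \<Rightarrow> 'u coefs \<Rightarrow> bool" where
  "ls_optimal Q S A f w \<longleftrightarrow> is_arg_min (ls_loss Q S A f) (\<lambda>_. True) w"

text \<open>One step of the optimal random feature solution, from the state \<open>v\<close> to the coefficient
  vector \<open>c\<close>: the stages minimise the losses of the successive stage systems, and \<open>c\<close> minimises
  the loss of the collocated update formula. For a stiffly accurate tableau the update formula is
  the fourth stage equation, and \<open>c\<close> may as well be the coefficient vector of that stage.\<close>

definition optimal_rfm_step :: "(real \<Rightarrow> real) \<Rightarrow> (real \<Rightarrow> real) \<Rightarrow> ('d::finite) rfm_space \<Rightarrow>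
    (real ^ 'd) set \<Rightarrow> imex_tableau \<Rightarrow> real \<Rightarrow>
    (('d, 'u::finite) field \<Rightarrow> ('d, 'u) field) \<Rightarrow> (('d, 'u) field \<Rightarrow> ('d, 'u) field) \<Rightarrow>
    ('d, 'u) field \<Rightarrow> 'u coefs \<Rightarrow> bool" where
  "optimal_rfm_step \<sigma> \<psi> S Q tab dt Lop Gop v c \<longleftrightarrow>
     (\<exists>W :: nat \<Rightarrow> 'u coefs.
        (\<forall>i\<in>{1..4}. ls_optimal Q S (colloc_matrix \<sigma> \<psi> S Lop (dt * im_a tab i i))
           (stage_rhs tab dt Lop Gop v (\<lambda>j. rfm_fun \<sigma> \<psi> S (W j)) i) (W i)) \<and>
        (ls_optimal Q S (colloc_matrix \<sigma> \<psi> S Lop 0)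
           (\<lambda>x. v x + dt *\<^sub>R stage_increment tab Lop Gop (\<lambda>i. rfm_fun \<sigma> \<psi> S (W i)) x) c \<or>
         stiffly_accurate tab \<and> c = W 4))"


subsection \<open>The coefficient perturbation model\<close>

text \<open>\<open>J\<close> orthonormal vectors of \<open>\<real>\<^sup>J\<close> form a basis.\<close>

definition orthonormal_basis :: "nat \<Rightarrow> (nat \<Rightarrow> nat \<Rightarrow> real) \<Rightarrow> bool" where
  "orthonormal_basis J \<beta> \<longleftrightarrow>
     (\<forall>l<J. \<forall>l'<J. (\<Sum>i<J. \<beta> l i * \<beta> l' i) = (if l = l' then 1 else 0))"

definition iid_perturbation :: "'w measure \<Rightarrow> nat \<Rightarrow> (nat \<Rightarrow> 'w \<Rightarrow> real) \<Rightarrow> real \<Rightarrow> real \<Rightarrow> bool" where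
  "iid_perturbation P J X \<mu> \<delta> \<longleftrightarrow>
     prob_space.indep_vars P (\<lambda>_. borel) X {..<J} \<and>
     (\<forall>j<J. \<forall>j'<J. distr P borel (X j) = distr P borel (X j')) \<and>
     (\<forall>j<J. integrable P (X j) \<and> (\<integral>\<omega>. X j \<omega> \<partial>P) = 0 \<and>
            (\<integral>\<omega>. \<bar>X j \<omega>\<bar> \<partial>P) = \<mu> \<and>
            integrable P (\<lambda>\<omega>. (X j \<omega>)\<^sup>2) \<and> (\<integral>\<omega>. (X j \<omega>)\<^sup>2 \<partial>P) = \<delta>\<^sup>2)"

text \<open>\<open>Uh\<close> (random) and \<open>Ut\<close> are the numerical and the optimal coefficients. The variables of one
  subdomain and one component are i.i.d.; nothing is assumed about the joint distribution of
  variables that belong to different subdomains or components.\<close>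

definition perturbed_coefs :: "'w measure \<Rightarrow> ('d::finite) rfm_space \<Rightarrow> real \<Rightarrow> real \<Rightarrow>
    ('u \<Rightarrow> nat \<Rightarrow> nat \<Rightarrow> nat \<Rightarrow> real) \<Rightarrow> ('u \<Rightarrow> nat \<Rightarrow> nat \<Rightarrow> 'w \<Rightarrow> real) \<Rightarrow>
    'u coefs \<Rightarrow> ('w \<Rightarrow> 'u coefs) \<Rightarrow> bool" where
  "perturbed_coefs P S \<mu> \<delta> \<beta> du Ut Uh \<longleftrightarrow>
     (\<forall>k. \<forall>m<rfm_M S. orthonormal_basis (rfm_J S) (\<beta> k m) \<and>
        iid_perturbation P (rfm_J S) (du k m) \<mu> \<delta> \<and>
        (\<forall>\<omega>\<in>space P. \<forall>i<rfm_J S.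
           Uh \<omega> k m i - Ut k m i = (\<Sum>l<rfm_J S. du k m l \<omega> * \<beta> k m l i)))"

end

theory Submission
  imports Defs
begin

text \<open>The error splits into the coefficient perturbation, the approximation error of the optimal
  solution and the global error of the time stepping scheme. The last one is controlled by a
  discrete Gronwall argument. For the first one, each random feature is bounded by a constant that
  depends only on \<open>\<sigma>\<close>, \<open>\<psi>\<close> and \<open>R\<close>, and vanishes outside a fixed dilation of its
  subdomain. The perturbations of one subdomain and component are uncorrelated, so their mean square
  is at most \<open>\<delta>\<^sup>2\<close> times the sum of the squared norms of the features, by Bessel's
  inequality. Different subdomains are combined by the Cauchy-Schwarz inequality, which costs only
  the factor \<open>M\<close> of the estimate, because the dilated subdomains have total volume proportional to
  that of the bounding box, independently of the partition.\<close>

section \<open>Piecewise continuous functions\<close>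

text \<open>The exceptional set meets every bounded interval in a finite set, so exhausting the line
  by the intervals from \<open>- real n\<close> to \<open>real n\<close> shows that it is countable.
  Continuity off a countable set suffices for Borel measurability.\<close>

lemma piecewise_continuous_borel_measurable:
  assumes "piecewise_continuous f"
  shows "f \<in> borel_measurable borel"
proof -
  obtain S where S: "\<And>a b. finite (S \<inter> {a..b})" "\<And>x. x \<notin> S \<Longrightarrow> isCont f x"
    using assms unfolding piecewise_continuous_def by auto
  have "S = (\<Union>n::nat. S \<inter> {- real n..real n})"
  proof (intro set_eqI iffI)
    fix x assume "x \<in> S"
    moreover obtain n :: nat where "\<bar>x\<bar> \<le> real n" using real_arch_simple by blast
    ultimately have "x \<in> S \<inter> {- real n..real n}" by auto
    then show "x \<in> (\<Union>n::nat. S \<inter> {- real n..real n})" by blast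
  qed auto
  also have "countable \<dots>" using S(1) by (intro countable_UN) (auto intro: countable_finite)
  finally have "countable S" .
  moreover have "continuous_on (- S) f"
    using S(2) by (intro continuous_at_imp_continuous_on) auto
  ultimately show ?thesis by (rule borel_measurable_continuous_countable_exceptions)
qed

text \<open>One-sided limits bound \<open>f\<close> near each point, and compactness of the interval
  leaves finitely many local bounds. Activations may be unbounded on the whole line; this local
  bound is what replaces global boundedness.\<close>

lemma piecewise_continuous_bounded:
  assumes "piecewise_continuous f"
  obtains B where "B > 0" "\<And>x. a \<le> x \<Longrightarrow> x \<le> b \<Longrightarrow> \<bar>f x\<bar> \<le> B"
proof -
  have "\<exists>U C. open U \<and> x \<in> U \<and> (\<forall>y\<in>U. \<bar>f y\<bar> \<le> C)" for x
  proof -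
    obtain l r where l: "(f \<longlongrightarrow> l) (at_left x)" and r: "(f \<longlongrightarrow> r) (at_right x)"
      using piecewise_continuous_one_sided[OF assms] by blast
    have "eventually (\<lambda>y. \<bar>f y\<bar> < \<bar>l\<bar> + 1) (at_left x)"
      using tendsto_rabs[OF l] by (rule order_tendstoD) simp
    moreover have "eventually (\<lambda>y. \<bar>f y\<bar> < \<bar>r\<bar> + 1) (at_right x)"
      using tendsto_rabs[OF r] by (rule order_tendstoD) simp
    ultimately have "eventually (\<lambda>y. \<bar>f y\<bar> \<le> \<bar>l\<bar> + \<bar>r\<bar> + 1) (at x)"
      unfolding eventually_at_split by (auto elim!: eventually_mono)
    then obtain U where "open U" "x \<in> U" "\<And>y. y \<in> U \<Longrightarrow> y \<noteq> x \<Longrightarrow> \<bar>f y\<bar> \<le> \<bar>l\<bar> + \<bar>r\<bar> + 1"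
      unfolding eventually_at_topological by auto
    \<comment> \<open>The limits say nothing about the value at \<open>x\<close> itself, so it is
      added to the bound.\<close>
    then have "open U \<and> x \<in> U \<and> (\<forall>y\<in>U. \<bar>f y\<bar> \<le> \<bar>l\<bar> + \<bar>r\<bar> + 1 + \<bar>f x\<bar>)"
      by (force intro: add_increasing2)
    then show ?thesis by blast
  qed
  then obtain U C where UC: "\<And>x. open (U x)" "\<And>x. x \<in> U x" "\<And>x y. y \<in> U x \<Longrightarrow> \<bar>f y\<bar> \<le> C x"
    by metis
  obtain F where F: "F \<subseteq> {a..b}" "finite F" "{a..b} \<subseteq> (\<Union>x\<in>F. U x)"
    using compactE_image[of "{a..b}" "{a..b}" U] UC(1,2) by (metis UN_I compact_Icc subsetI)
  show ?thesis
  proof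
    \<comment> \<open>The sum of the local bounds replaces their maximum, and the summand 1 keeps
      the constant positive even if \<open>F\<close> is empty.\<close>
    show "(\<Sum>x\<in>F. \<bar>C x\<bar>) + 1 > 0" by (simp add: sum_nonneg add_nonneg_pos)
    fix y assume "a \<le> y" "y \<le> b"
    then obtain x where x: "x \<in> F" "y \<in> U x" using F(3) by force
    have "\<bar>f y\<bar> \<le> \<bar>C x\<bar>" using UC(3)[OF x(2)] by simp
    also have "\<dots> \<le> (\<Sum>x\<in>F. \<bar>C x\<bar>)" using x F(2) by (intro member_le_sum) auto
    finally show "\<bar>f y\<bar> \<le> (\<Sum>x\<in>F. \<bar>C x\<bar>) + 1" by simp
  qed
qed

section \<open>Square-integrable functions\<close>

lemma integrable_mult_of_square_integrable:
  fixes f g :: "'a \<Rightarrow> real"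
  assumes [measurable]: "f \<in> borel_measurable M" "g \<in> borel_measurable M"
    and "integrable M (\<lambda>x. (f x)\<^sup>2)" "integrable M (\<lambda>x. (g x)\<^sup>2)"
  shows "integrable M (\<lambda>x. f x * g x)"
proof (rule Bochner_Integration.integrable_bound)
  show "integrable M (\<lambda>x. (f x)\<^sup>2 + (g x)\<^sup>2)" using assms by simp
  show "AE x in M. norm (f x * g x) \<le> norm ((f x)\<^sup>2 + (g x)\<^sup>2)"
  proof (rule AE_I2)
    fix x
    have "0 \<le> (\<bar>f x\<bar> - \<bar>g x\<bar>)\<^sup>2" by simp
    then have "2 * \<bar>f x * g x\<bar> \<le> (f x)\<^sup>2 + (g x)\<^sup>2" by (simp add: power2_diff abs_mult)
    then show "norm (f x * g x) \<le> norm ((f x)\<^sup>2 + (g x)\<^sup>2)" by simp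
  qed
qed measurable

text \<open>Young's inequality with a free weight: after the triangle inequality, the defect is the
  square of \<open>s * norm a - norm b\<close> divided by \<open>s\<close>. Optimising
  \<open>s\<close> after integration yields the triangle inequality in the mean-square norm.\<close>

lemma norm_add_square_le:
  fixes a b :: "'a::real_normed_vector"
  assumes "s > 0"
  shows "(norm (a + b))\<^sup>2 \<le> (1 + s) * (norm a)\<^sup>2 + (1 + 1 / s) * (norm b)\<^sup>2"
proof -
  have "(norm (a + b))\<^sup>2 \<le> (norm a + norm b)\<^sup>2"
    by (intro power_mono norm_triangle_ineq) simp
  also have "\<dots> = (1 + s) * (norm a)\<^sup>2 + (1 + 1 / s) * (norm b)\<^sup>2 - (s * norm a - norm b)\<^sup>2 / s"
    using assms by (simp add: power2_eq_square field_simps)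
  also have "\<dots> \<le> (1 + s) * (norm a)\<^sup>2 + (1 + 1 / s) * (norm b)\<^sup>2" using assms by simp
  finally show ?thesis .
qed

lemma L2_norm_nonneg [simp]: "L2_norm \<Omega> f \<ge> 0"
  by (simp add: L2_norm_def)

lemma L2_norm_square: "(L2_norm \<Omega> f)\<^sup>2 = (\<integral>x. (norm (f x))\<^sup>2 \<partial>lebesgue_on \<Omega>)"
  by (simp add: L2_norm_def)

lemma L2_norm_cong:
  assumes "\<And>x. x \<in> \<Omega> \<Longrightarrow> norm (f x) = norm (g x)"
  shows "L2_norm \<Omega> f = L2_norm \<Omega> g"
  unfolding L2_norm_def by (intro arg_cong[of _ _ sqrt] Bochner_Integration.integral_cong) (auto simp: assms)

lemma in_L2_scaleR: "in_L2 \<Omega> f \<Longrightarrow> in_L2 \<Omega> (\<lambda>x. c *\<^sub>R f x)"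
  by (auto simp: in_L2_def power_mult_distrib)

lemma L2_norm_scaleR: "L2_norm \<Omega> (\<lambda>x. c *\<^sub>R f x) = \<bar>c\<bar> * L2_norm \<Omega> f"
  by (simp add: L2_norm_def power_mult_distrib real_sqrt_mult)

lemma in_L2_add:
  assumes "in_L2 \<Omega> f" "in_L2 \<Omega> g"
  shows "in_L2 \<Omega> (\<lambda>x. f x + g x)"
proof -
  have [measurable]: "f \<in> borel_measurable (lebesgue_on \<Omega>)" "g \<in> borel_measurable (lebesgue_on \<Omega>)"
    using assms by (auto simp: in_L2_def)
  have "integrable (lebesgue_on \<Omega>) (\<lambda>x. (norm (f x + g x))\<^sup>2)"
  proof (rule Bochner_Integration.integrable_bound)
    show "integrable (lebesgue_on \<Omega>) (\<lambda>x. 2 * (norm (f x))\<^sup>2 + 2 * (norm (g x))\<^sup>2)"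
      using assms by (simp add: in_L2_def)
    show "AE x in lebesgue_on \<Omega>. norm ((norm (f x + g x))\<^sup>2)
            \<le> norm (2 * (norm (f x))\<^sup>2 + 2 * (norm (g x))\<^sup>2)"
      using norm_add_square_le[of 1] by (intro AE_I2) simp
  qed measurable
  then show ?thesis by (simp add: in_L2_def)
qed

lemma in_L2_diff:
  assumes "in_L2 \<Omega> f" "in_L2 \<Omega> g"
  shows "in_L2 \<Omega> (\<lambda>x. f x - g x)"
  using in_L2_add[OF assms(1) in_L2_scaleR[OF assms(2), of "- 1"]] by simp

text \<open>Minkowski's inequality without a detour through Cauchy-Schwarz: the integrated Young
  inequality holds for every weight, and at the right weight its right-hand side is a perfect
  square.\<close>

lemma L2_norm_triangle:
  assumes "in_L2 \<Omega> f" "in_L2 \<Omega> g"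
  shows "L2_norm \<Omega> (\<lambda>x. f x + g x) \<le> L2_norm \<Omega> f + L2_norm \<Omega> g"
proof (rule field_le_epsilon)
  fix e :: real assume "e > 0"
  define A where "A = L2_norm \<Omega> f + e / 2"
  define B where "B = L2_norm \<Omega> g + e / 2"
  have AB: "A > 0" "B > 0" "L2_norm \<Omega> f \<le> A" "L2_norm \<Omega> g \<le> B"
    using \<open>e > 0\<close> by (simp_all add: A_def B_def add_nonneg_pos)
  \<comment> \<open>This \<open>s\<close> is the optimal weight in \<open>norm_add_square_le\<close>; the summand \<open>e / 2\<close> avoids zero norms.\<close>
  define s where "s = B / A"
  have s: "s > 0" using AB by (simp add: s_def)
  have "(L2_norm \<Omega> (\<lambda>x. f x + g x))\<^sup>2
      \<le> (\<integral>x. (1 + s) * (norm (f x))\<^sup>2 + (1 + 1 / s) * (norm (g x))\<^sup>2 \<partial>lebesgue_on \<Omega>)"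
    unfolding L2_norm_square
    using assms in_L2_add[OF assms] s by (intro integral_mono norm_add_square_le) (auto simp: in_L2_def)
  also have "\<dots> = (1 + s) * (L2_norm \<Omega> f)\<^sup>2 + (1 + 1 / s) * (L2_norm \<Omega> g)\<^sup>2"
    using assms by (simp add: in_L2_def L2_norm_square)
  also have "\<dots> \<le> (1 + s) * A\<^sup>2 + (1 + 1 / s) * B\<^sup>2"
    using AB s by (intro add_mono mult_left_mono power_mono) auto
  also have "\<dots> = (A + B)\<^sup>2" using AB by (simp add: s_def power2_eq_square field_simps)
  finally have "L2_norm \<Omega> (\<lambda>x. f x + g x) \<le> A + B"
    using AB by (auto intro: power2_le_imp_le)
  then show "L2_norm \<Omega> (\<lambda>x. f x + g x) \<le> L2_norm \<Omega> f + L2_norm \<Omega> g + e"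
    by (simp add: A_def B_def)
qed

section \<open>Random quadratic forms\<close>

text \<open>Independent centred variables are uncorrelated, so all off-diagonal terms have mean zero
  and only the trace of \<open>G\<close> survives, multiplied by the common variance.\<close>

lemma iid_perturbation_quadratic_form:
  assumes P: "prob_space P" and X: "iid_perturbation P J X \<mu> \<delta>"
  shows "integrable P (\<lambda>\<omega>. \<Sum>l<J. \<Sum>l'<J. X l \<omega> * X l' \<omega> * G l l')"
    and "(\<integral>\<omega>. (\<Sum>l<J. \<Sum>l'<J. X l \<omega> * X l' \<omega> * G l l') \<partial>P) = \<delta>\<^sup>2 * (\<Sum>l<J. G l l)"
proof -
  interpret prob_space P by (rule P)
  have ind: "indep_vars (\<lambda>_. borel) X {..<J}"
    and int: "\<And>l. l < J \<Longrightarrow> integrable P (X l)" "\<And>l. l < J \<Longrightarrow> (\<integral>\<omega>. X l \<omega> \<partial>P) = 0"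
    and sq: "\<And>l. l < J \<Longrightarrow> integrable P (\<lambda>\<omega>. (X l \<omega>)\<^sup>2)" "\<And>l. l < J \<Longrightarrow> (\<integral>\<omega>. (X l \<omega>)\<^sup>2 \<partial>P) = \<delta>\<^sup>2"
    using X by (auto simp: iid_perturbation_def)
  have cov: "integrable P (\<lambda>\<omega>. X l \<omega> * X l' \<omega>)
      \<and> (\<integral>\<omega>. X l \<omega> * X l' \<omega> \<partial>P) = (if l = l' then \<delta>\<^sup>2 else 0)" if l: "l < J" "l' < J" for l l'
  proof (cases "l = l'")
    case True
    then show ?thesis using sq l by (simp add: power2_eq_square)
  next
    case False
    have i: "indep_vars (\<lambda>_. borel) X {l, l'}"
      using ind l by (auto intro: indep_vars_subset)
    have "integrable P (X k)" if "k \<in> {l, l'}" for k using int l that by auto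
    then show ?thesis
      using indep_vars_integrable[OF _ i] indep_vars_lebesgue_integral[OF _ i] False int(2) l
      by simp
  qed
  show "integrable P (\<lambda>\<omega>. \<Sum>l<J. \<Sum>l'<J. X l \<omega> * X l' \<omega> * G l l')"
    using cov by (intro Bochner_Integration.integrable_sum integrable_mult_left) auto
  have "(\<integral>\<omega>. (\<Sum>l<J. \<Sum>l'<J. X l \<omega> * X l' \<omega> * G l l') \<partial>P)
      = (\<Sum>l<J. \<Sum>l'<J. (\<integral>\<omega>. X l \<omega> * X l' \<omega> * G l l' \<partial>P))"
    using cov by (subst Bochner_Integration.integral_sum, force,
      intro sum.cong refl Bochner_Integration.integral_sum) (auto intro!: integrable_mult_left)
  also have "\<dots> = (\<Sum>l<J. \<Sum>l'<J. if l = l' then \<delta>\<^sup>2 * G l l' else 0)"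
    using cov by (intro sum.cong refl) auto
  also have "\<dots> = \<delta>\<^sup>2 * (\<Sum>l<J. G l l)"
    by (simp add: sum.delta sum_distrib_left)
  finally show "(\<integral>\<omega>. (\<Sum>l<J. \<Sum>l'<J. X l \<omega> * X l' \<omega> * G l l') \<partial>P) = \<delta>\<^sup>2 * (\<Sum>l<J. G l l)" .
qed

text \<open>The squared distance of \<open>h\<close> from its expansion in the \<beta> vectors is
  nonnegative. Equality would hold by completeness, but the inequality needs orthonormality
  only.\<close>

lemma orthonormal_basis_bessel:
  assumes "orthonormal_basis J \<beta>"
  shows "(\<Sum>l<J. (\<Sum>i<J. \<beta> l i * h i)\<^sup>2) \<le> (\<Sum>i<J. (h i)\<^sup>2)"
proof -
  define c where "c l = (\<Sum>i<J. \<beta> l i * h i)" for l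
  \<comment> \<open>Facts \<open>1\<close> and \<open>2\<close> evaluate the inner product of
    \<open>h\<close> with its expansion and the squared norm of that expansion; both equal the sum
    of the squared coefficients.\<close>
  have 1: "(\<Sum>i<J. h i * (\<Sum>l<J. c l * \<beta> l i)) = (\<Sum>l<J. (c l)\<^sup>2)"
  proof -
    have "(\<Sum>i<J. h i * (\<Sum>l<J. c l * \<beta> l i)) = (\<Sum>i<J. \<Sum>l<J. c l * (\<beta> l i * h i))"
      by (simp add: sum_distrib_left mult_ac)
    also have "\<dots> = (\<Sum>l<J. \<Sum>i<J. c l * (\<beta> l i * h i))" by (rule sum.swap)
    also have "\<dots> = (\<Sum>l<J. (c l)\<^sup>2)"
      by (simp add: c_def power2_eq_square flip: sum_distrib_left)
    finally show ?thesis .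
  qed
  have 2: "(\<Sum>i<J. (\<Sum>l<J. c l * \<beta> l i)\<^sup>2) = (\<Sum>l<J. (c l)\<^sup>2)"
  proof -
    have "(\<Sum>i<J. (\<Sum>l<J. c l * \<beta> l i)\<^sup>2)
        = (\<Sum>i<J. \<Sum>l<J. \<Sum>l'<J. c l * c l' * (\<beta> l i * \<beta> l' i))"
      by (simp add: power2_eq_square sum_product mult_ac)
    also have "\<dots> = (\<Sum>l<J. \<Sum>i<J. \<Sum>l'<J. c l * c l' * (\<beta> l i * \<beta> l' i))" by (rule sum.swap)
    also have "\<dots> = (\<Sum>l<J. \<Sum>l'<J. \<Sum>i<J. c l * c l' * (\<beta> l i * \<beta> l' i))"
      by (intro sum.cong refl sum.swap)
    also have "\<dots> = (\<Sum>l<J. \<Sum>l'<J. c l * c l' * (if l = l' then 1 else 0))"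
      using assms unfolding orthonormal_basis_def
      by (intro sum.cong refl) (simp flip: sum_distrib_left)
    also have "\<dots> = (\<Sum>l<J. (c l)\<^sup>2)"
      by (simp add: power2_eq_square if_distrib[of "(*) _"] sum.delta cong: if_cong)
    finally show ?thesis .
  qed
  have "0 \<le> (\<Sum>i<J. (h i - (\<Sum>l<J. c l * \<beta> l i))\<^sup>2)" by (intro sum_nonneg) simp
  also have "\<dots> = (\<Sum>i<J. (h i)\<^sup>2) - 2 * (\<Sum>i<J. h i * (\<Sum>l<J. c l * \<beta> l i))
      + (\<Sum>i<J. (\<Sum>l<J. c l * \<beta> l i)\<^sup>2)"
    by (simp add: power2_diff sum.distrib sum_subtractf sum_distrib_left mult_ac)
  also have "\<dots> = (\<Sum>i<J. (h i)\<^sup>2) - (\<Sum>l<J. (c l)\<^sup>2)" unfolding 1 2 by simp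
  finally show ?thesis by (simp add: c_def)
qed

text \<open>Independence makes the cross terms vanish; without it the bound would lose a factor \<open>J\<close>.\<close>

lemma iid_perturbation_mean_square:
  fixes h :: "nat \<Rightarrow> 'a \<Rightarrow> real"
  assumes P: "prob_space P" and X: "iid_perturbation P J X \<mu> \<delta>"
    and \<beta>: "orthonormal_basis J \<beta>"
    and h[measurable]: "\<And>i. i < J \<Longrightarrow> h i \<in> borel_measurable N"
    and h2: "\<And>i. i < J \<Longrightarrow> integrable N (\<lambda>x. (h i x)\<^sup>2)"
  defines "Y \<equiv> \<lambda>\<omega>. \<integral>x. (\<Sum>i<J. (\<Sum>l<J. X l \<omega> * \<beta> l i) * h i x)\<^sup>2 \<partial>N"
  shows "integrable P Y" "(\<integral>\<omega>. Y \<omega> \<partial>P) \<le> \<delta>\<^sup>2 * (\<Sum>i<J. \<integral>x. (h i x)\<^sup>2 \<partial>N)"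
proof -
  \<comment> \<open>Expanding the features along \<beta> turns \<open>Y\<close> into a quadratic
    form in the variables \<open>X\<close>, whose matrix \<open>G\<close> is the Gram matrix of the
    rotated features \<open>g\<close>.\<close>
  define g where "g l x = (\<Sum>i<J. \<beta> l i * h i x)" for l x
  define G where "G l l' = (\<integral>x. g l x * g l' x \<partial>N)" for l l'
  have hh: "integrable N (\<lambda>x. h i x * h j x)" if "i < J" "j < J" for i j
    using that h h2 by (intro integrable_mult_of_square_integrable) auto
  have gg: "integrable N (\<lambda>x. g l x * g l' x)" for l l'
    unfolding g_def sum_product
    using hh by (auto intro!: Bochner_Integration.integrable_sum simp: mult.assoc mult.left_commute[of "h _ _"])
  have Y: "Y = (\<lambda>\<omega>. \<Sum>l<J. \<Sum>l'<J. X l \<omega> * X l' \<omega> * G l l')"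
  proof
    fix \<omega>
    have "(\<Sum>i<J. (\<Sum>l<J. X l \<omega> * \<beta> l i) * h i x) = (\<Sum>l<J. X l \<omega> * g l x)" for x
      unfolding g_def sum_distrib_left sum_distrib_right
      by (subst sum.swap) (simp add: mult.assoc)
    then have "Y \<omega> = (\<integral>x. (\<Sum>l<J. \<Sum>l'<J. X l \<omega> * X l' \<omega> * (g l x * g l' x)) \<partial>N)"
      unfolding Y_def by (simp add: power2_eq_square sum_product mult_ac)
    also have "\<dots> = (\<Sum>l<J. \<Sum>l'<J. X l \<omega> * X l' \<omega> * G l l')"
      unfolding G_def using gg
      by (simp add: Bochner_Integration.integral_sum)
    finally show "Y \<omega> = (\<Sum>l<J. \<Sum>l'<J. X l \<omega> * X l' \<omega> * G l l')" .
  qed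
  show "integrable P Y" unfolding Y by (rule iid_perturbation_quadratic_form[OF P X])
  have "(\<integral>\<omega>. Y \<omega> \<partial>P) = \<delta>\<^sup>2 * (\<Sum>l<J. G l l)"
    unfolding Y by (rule iid_perturbation_quadratic_form[OF P X])
  \<comment> \<open>The trace of the Gram matrix is the integral of the pointwise sum of squares, to
    which Bessel's inequality applies for each \<open>x\<close> separately.\<close>
  also have "(\<Sum>l<J. G l l) = (\<integral>x. (\<Sum>l<J. (g l x)\<^sup>2) \<partial>N)"
    unfolding G_def using gg by (simp add: Bochner_Integration.integral_sum power2_eq_square)
  also have "\<dots> \<le> (\<integral>x. (\<Sum>i<J. (h i x)\<^sup>2) \<partial>N)"
    using gg h2 orthonormal_basis_bessel[OF \<beta>] unfolding g_def
    by (intro integral_mono) (auto simp: power2_eq_square)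
  also have "\<dots> = (\<Sum>i<J. \<integral>x. (h i x)\<^sup>2 \<partial>N)"
    using h2 by (intro Bochner_Integration.integral_sum) auto
  finally show "(\<integral>\<omega>. Y \<omega> \<partial>P) \<le> \<delta>\<^sup>2 * (\<Sum>i<J. \<integral>x. (h i x)\<^sup>2 \<partial>N)"
    by (simp add: mult_left_mono)
qed

section \<open>Random feature functions\<close>

lemma norm_vec_square: "(norm (x :: real ^ 'n::finite))\<^sup>2 = (\<Sum>k\<in>UNIV. (x $ k)\<^sup>2)"
  by (simp add: norm_vec_def L2_set_def sum_nonneg)

lemma borel_measurable_vec_nth [measurable (raw)]:
  fixes f :: "'a \<Rightarrow> real ^ 'n::finite"
  assumes "f \<in> borel_measurable M"
  shows "(\<lambda>x. f x $ k) \<in> borel_measurable M"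
  by (rule borel_measurable_continuous_on[OF _ assms]) (intro continuous_intros)

text \<open>Isolates the pattern of components, subdomains and a constant factor \<open>r\<close>,
  which later is the Cauchy-Schwarz factor \<open>M\<close>. It serves both for integrals over the
  domain and for expectations.\<close>

lemma integral_double_sum:
  fixes f :: "'k \<Rightarrow> 'i \<Rightarrow> 'a \<Rightarrow> real"
  assumes f: "\<And>k i. k \<in> A \<Longrightarrow> i \<in> I \<Longrightarrow> integrable N (f k i)"
  shows "integrable N (\<lambda>x. \<Sum>k\<in>A. (\<Sum>i\<in>I. f k i x) * r)"
    and "(\<integral>x. (\<Sum>k\<in>A. (\<Sum>i\<in>I. f k i x) * r) \<partial>N) = (\<Sum>k\<in>A. (\<Sum>i\<in>I. \<integral>x. f k i x \<partial>N) * r)"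
proof -
  have 1: "integrable N (\<lambda>x. (\<Sum>i\<in>I. f k i x) * r)" if "k \<in> A" for k
    using f[OF that] by (intro integrable_mult_left Bochner_Integration.integrable_sum)
  show "integrable N (\<lambda>x. \<Sum>k\<in>A. (\<Sum>i\<in>I. f k i x) * r)"
    by (intro Bochner_Integration.integrable_sum 1)
  have "(\<integral>x. (\<Sum>i\<in>I. f k i x) * r \<partial>N) = (\<Sum>i\<in>I. \<integral>x. f k i x \<partial>N) * r" if "k \<in> A" for k
    using f[OF that] by (simp add: Bochner_Integration.integral_sum)
  then show "(\<integral>x. (\<Sum>k\<in>A. (\<Sum>i\<in>I. f k i x) * r) \<partial>N) = (\<Sum>k\<in>A. (\<Sum>i\<in>I. \<integral>x. f k i x \<partial>N) * r)"
    using 1 by (simp only: Bochner_Integration.integral_sum cong: sum.cong)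
qed

lemma square_integrable_sum:
  fixes h :: "'i \<Rightarrow> 'a \<Rightarrow> real"
  assumes "\<And>i. i \<in> I \<Longrightarrow> h i \<in> borel_measurable N"
    and "\<And>i. i \<in> I \<Longrightarrow> integrable N (\<lambda>x. (h i x)\<^sup>2)"
  shows "integrable N (\<lambda>x. (\<Sum>i\<in>I. a i * h i x)\<^sup>2)"
proof -
  have "integrable N (\<lambda>x. a i * h i x * (a j * h j x))" if "i \<in> I" "j \<in> I" for i j
    using integrable_mult_right[of "a i * a j" N "\<lambda>x. h i x * h j x"]
      integrable_mult_of_square_integrable[of "h i" N "h j"] assms that by (simp add: mult_ac)
  then show ?thesis
    by (simp add: power2_eq_square sum_product)
qed

lemma rfm_basis_borel_measurable [measurable]:
  fixes S :: "'d::finite rfm_space"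
  assumes "activation \<sigma>" "pou_profile \<psi>"
  shows "rfm_basis \<sigma> \<psi> S m j \<in> borel_measurable borel"
proof -
  have [measurable]: "\<sigma> \<in> borel_measurable borel" "\<psi> \<in> borel_measurable borel"
    using assms by (auto simp: activation_def pou_profile_def intro: piecewise_continuous_borel_measurable)
  show ?thesis
    unfolding rfm_basis_def[abs_def] rescale_def inner_vec_def by simp
qed

text \<open>When \<rho> bounds the support of the profile \<psi>, this box contains the supports of
  all features of subdomain \<open>m\<close>. For \<open>psi_b\<close> that radius is 5/4, so
  neighbouring boxes overlap.\<close>

abbreviation dilated_subdomain :: "real \<Rightarrow> 'd rfm_space \<Rightarrow> nat \<Rightarrow> (real ^ 'd::finite) set" where
  "dilated_subdomain \<rho> S m \<equiv>
     cbox (rfm_center S m - \<rho> *\<^sub>R rfm_halfwidth S m) (rfm_center S m + \<rho> *\<^sub>R rfm_halfwidth S m)"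

text \<open>Where the factor \<psi> does not vanish, the rescaled coordinates are at most \<rho> in
  modulus; with parameters in \<open>[-R, R]\<close> the argument of \<sigma> then stays in a fixed
  compact interval. The constants are obtained before \<open>B\<close> and \<open>S\<close>, so they
  do not depend on the partition, the number of features or the sampled parameters.\<close>

lemma rfm_basis_bounded:
  assumes "activation \<sigma>" "pou_profile \<psi>" "R > 0"
  obtains b \<rho> where "b > 0" "\<rho> > 0"
    "\<And>B (S :: 'd::finite rfm_space) m j x. rfm_space_on B R S \<Longrightarrow> m < rfm_M S \<Longrightarrow> j < rfm_J S \<Longrightarrow>
       \<bar>rfm_basis \<sigma> \<psi> S m j x\<bar> \<le> b * indicator (dilated_subdomain \<rho> S m) x"
proof -
  obtain \<rho>' where "\<And>t. \<bar>t\<bar> > \<rho>' \<Longrightarrow> \<psi> t = 0"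
    using assms(2) by (auto simp: pou_profile_def)
  \<comment> \<open>The radius is raised to at least 1 to make it positive.\<close>
  then obtain \<rho> where \<rho>: "\<rho> > 0" "\<And>t. \<bar>t\<bar> > \<rho> \<Longrightarrow> \<psi> t = 0"
    by (meson less_le_trans max.cobounded1 max.cobounded2 max.strict_boundedE zero_less_one
        that[of "max \<rho>' 1"] order.strict_trans1)
  \<comment> \<open>Each of the coordinates contributes at most \<open>R * \<rho>\<close> to the
    inner product, and the bias contributes at most \<open>R\<close>.\<close>
  define r where "r = (\<Sum>i\<in>(UNIV::'d set). R * \<rho>) + R"
  obtain B\<^sub>\<psi> where B\<^sub>\<psi>: "B\<^sub>\<psi> > 0" "\<And>t. - \<rho> \<le> t \<Longrightarrow> t \<le> \<rho> \<Longrightarrow> \<bar>\<psi> t\<bar> \<le> B\<^sub>\<psi>"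
    using piecewise_continuous_bounded[of \<psi> "- \<rho>" \<rho>] assms(2) by (auto simp: pou_profile_def)
  obtain B\<^sub>\<sigma> where B\<^sub>\<sigma>: "B\<^sub>\<sigma> > 0" "\<And>t. - r \<le> t \<Longrightarrow> t \<le> r \<Longrightarrow> \<bar>\<sigma> t\<bar> \<le> B\<^sub>\<sigma>"
    using piecewise_continuous_bounded[of \<sigma> "- r" r] assms(1) by (auto simp: activation_def)
  show ?thesis
  proof (rule that[of "B\<^sub>\<psi> ^ CARD('d) * B\<^sub>\<sigma>" \<rho>])
    fix B and S :: "'d rfm_space" and m j x
    assume S: "rfm_space_on B R S" and mj: "m < rfm_M S" "j < rfm_J S"
    have pos: "rfm_halfwidth S m $ i > 0" for i using S mj by (auto simp: rfm_space_on_def)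
    have par: "\<bar>rfm_weight S m j $ i\<bar> \<le> R" "\<bar>rfm_bias S m j\<bar> \<le> R" for i
      using S mj by (auto simp: rfm_space_on_def)
    show "\<bar>rfm_basis \<sigma> \<psi> S m j x\<bar> \<le> B\<^sub>\<psi> ^ CARD('d) * B\<^sub>\<sigma> * indicator (dilated_subdomain \<rho> S m) x"
    proof (cases "\<forall>i. \<bar>rescale S m x $ i\<bar> \<le> \<rho>")
      case False
      then obtain i where "\<psi> (rescale S m x $ i) = 0" using \<rho>(2) by (auto simp: not_le)
      then have "(\<Prod>i\<in>UNIV. \<psi> (rescale S m x $ i)) = 0" by (intro prod_zero) auto
      then have "rfm_basis \<sigma> \<psi> S m j x = 0" by (simp only: rfm_basis_def mult_zero_left)
      then show ?thesis using B\<^sub>\<psi>(1) B\<^sub>\<sigma>(1) by simp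
    next
      case True
      have "\<bar>x $ i - rfm_center S m $ i\<bar> \<le> \<rho> * rfm_halfwidth S m $ i" for i
        using True[rule_format, of i] pos[of i] by (simp add: rescale_def abs_divide divide_le_eq)
      then have "rfm_center S m $ i - \<rho> * rfm_halfwidth S m $ i \<le> x $ i
          \<and> x $ i \<le> rfm_center S m $ i + \<rho> * rfm_halfwidth S m $ i" for i
        by (smt (verit))
      then have x: "x \<in> dilated_subdomain \<rho> S m" by (simp add: mem_box_cart)
      have "\<bar>rfm_weight S m j \<bullet> rescale S m x\<bar> \<le> (\<Sum>i\<in>UNIV. \<bar>rfm_weight S m j $ i * rescale S m x $ i\<bar>)"
        by (simp add: inner_vec_def)
      also have "\<dots> \<le> (\<Sum>i\<in>(UNIV::'d set). R * \<rho>)"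
        using True par(1) \<open>R > 0\<close> by (intro sum_mono) (auto simp: abs_mult intro!: mult_mono)
      finally have "\<bar>rfm_weight S m j \<bullet> rescale S m x + rfm_bias S m j\<bar> \<le> r"
        using par(2) by (auto simp: r_def)
      then have "\<bar>\<sigma> (rfm_weight S m j \<bullet> rescale S m x + rfm_bias S m j)\<bar> \<le> B\<^sub>\<sigma>"
        by (intro B\<^sub>\<sigma>) auto
      moreover have "\<bar>\<Prod>i\<in>UNIV. \<psi> (rescale S m x $ i)\<bar> \<le> (\<Prod>i\<in>(UNIV::'d set). B\<^sub>\<psi>)"
        unfolding abs_prod
      proof (intro prod_mono conjI abs_ge_zero B\<^sub>\<psi>(2))
        fix i
        show "- \<rho> \<le> rescale S m x $ i" "rescale S m x $ i \<le> \<rho>"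
          using True[rule_format, of i] by auto
      qed
      ultimately show ?thesis
        using x B\<^sub>\<psi>(1) by (auto simp: rfm_basis_def abs_mult intro!: mult_mono)
    qed
  qed (use \<rho> B\<^sub>\<psi> B\<^sub>\<sigma> in auto)
qed

text \<open>Dilation multiplies each volume by the same power of \<rho>, and the undilated boxes
  tile the bounding box up to null sets. The number of subdomains therefore drops out of the total
  volume.\<close>

lemma measure_dilated_subdomains:
  fixes S :: "'d::finite rfm_space"
  assumes S: "rfm_space_on (cbox lo hi) R S" and "\<rho> > 0"
  shows "(\<Sum>m<rfm_M S. measure lebesgue (dilated_subdomain \<rho> S m))
    = \<rho> ^ CARD('d) * measure lebesgue (cbox lo hi)"
proof -
  have pos: "rfm_halfwidth S m $ i > 0" if "m < rfm_M S" for m i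
    using S that by (auto simp: rfm_space_on_def)
  \<comment> \<open>The factor \<open>t\<close> is kept free: it is taken to be 1 for the subdomains
    themselves and \<rho> for the dilated ones.\<close>
  have dil: "measure lebesgue (dilated_subdomain t S m) = t ^ CARD('d) * (\<Prod>i\<in>UNIV. 2 * rfm_halfwidth S m $ i)"
    if "t > 0" "m < rfm_M S" for t m
  proof -
    have "- (t * rfm_halfwidth S m $ i) \<le> t * rfm_halfwidth S m $ i" for i
      using pos[OF that(2), of i] \<open>t > 0\<close> by (auto intro: order_trans[of _ 0])
    then have "rfm_center S m \<in> dilated_subdomain t S m"
      using pos[OF that(2)] \<open>t > 0\<close> by (auto simp: mem_box_cart less_imp_le)
    then have "measure lebesgue (dilated_subdomain t S m) = (\<Prod>i\<in>UNIV. t * (2 * rfm_halfwidth S m $ i))"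
      using content_cbox_cart[of "rfm_center S m - t *\<^sub>R rfm_halfwidth S m"
          "rfm_center S m + t *\<^sub>R rfm_halfwidth S m"] by (auto simp: algebra_simps intro!: prod.cong)
    then show ?thesis by (simp add: prod.distrib)
  qed
  have "measure lebesgue (cbox lo hi) = measure lebesgue (\<Union>m<rfm_M S. subdomain S m)"
    using S by (simp add: rfm_space_on_def)
  also have "\<dots> = (\<Sum>m<rfm_M S. measure lebesgue (subdomain S m))"
  proof (rule measure_negligible_finite_Union_image)
    show "pairwise (\<lambda>m m'. negligible (subdomain S m \<inter> subdomain S m')) {..<rfm_M S}"
    proof (rule pairwiseI)
      fix m m' assume "m \<in> {..<rfm_M S}" "m' \<in> {..<rfm_M S}" "m \<noteq> m'"
      \<comment> \<open>Two distinct boxes meet in a convex set with empty interior, which is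
        negligible.\<close>
      then have "interior (subdomain S m \<inter> subdomain S m') = {}"
        using S by (auto simp: rfm_space_on_def)
      moreover have "convex (subdomain S m \<inter> subdomain S m')"
        by (simp add: subdomain_def convex_Int)
      ultimately show "negligible (subdomain S m \<inter> subdomain S m')"
        using negligible_convex_interior by blast
    qed
  qed (auto simp: subdomain_def)
  also have "\<dots> = (\<Sum>m<rfm_M S. \<Prod>i\<in>UNIV. 2 * rfm_halfwidth S m $ i)"
    using dil[of 1] by (simp add: subdomain_def)
  finally show ?thesis
    unfolding sum_distrib_left using dil[OF \<open>\<rho> > 0\<close>] by (simp add: sum_distrib_left)
qed

lemma rfm_fun_square:
  "(norm (rfm_fun \<sigma> \<psi> S w x))\<^sup>2
    = (\<Sum>k\<in>UNIV. (\<Sum>m<rfm_M S. \<Sum>j<rfm_J S. w k m j * rfm_basis \<sigma> \<psi> S m j x)\<^sup>2)"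
  by (simp add: norm_vec_square rfm_fun_def)

lemma rfm_fun_diff:
  "rfm_fun \<sigma> \<psi> S w x - rfm_fun \<sigma> \<psi> S w' x = rfm_fun \<sigma> \<psi> S (\<lambda>k m j. w k m j - w' k m j) x"
  by (simp add: rfm_fun_def vec_eq_iff left_diff_distrib sum_subtractf)

section \<open>Mean-square estimates on \<Omega> with \<open>b\<close> and \<rho> fixed before the
  feature space\<close>

context
  fixes \<sigma> \<psi> :: "real \<Rightarrow> real" and \<Omega> :: "(real ^ 'd::finite) set" and lo hi :: "real ^ 'd"
    and R b \<rho> :: real
  assumes \<Omega>: "open \<Omega>" "bounded \<Omega>"
    and \<sigma>: "activation \<sigma>" and \<psi>: "pou_profile \<psi>" and b: "b > 0" and \<rho>: "\<rho> > 0"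
    and bound: "\<And>(S :: 'd rfm_space) m j x. rfm_space_on (cbox lo hi) R S \<Longrightarrow> m < rfm_M S \<Longrightarrow>
       j < rfm_J S \<Longrightarrow> \<bar>rfm_basis \<sigma> \<psi> S m j x\<bar> \<le> b * indicator (dilated_subdomain \<rho> S m) x"
begin

lemma lmeasurable_domain: "\<Omega> \<in> lmeasurable"
  using \<Omega> by (simp add: bounded_set_imp_lmeasurable lmeasurable_open)

lemma rfm_basis_measurable_on: "rfm_basis \<sigma> \<psi> S m j \<in> borel_measurable (lebesgue_on \<Omega>)"
  by (intro measurable_restrict_space1 measurable_completion)
    (simp add: rfm_basis_borel_measurable \<sigma> \<psi>)

lemma rfm_basis_square:
  assumes "rfm_space_on (cbox lo hi) R S" "m < rfm_M S" "j < rfm_J S"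
  shows "integrable (lebesgue_on \<Omega>) (\<lambda>x. (rfm_basis \<sigma> \<psi> S m j x)\<^sup>2)"
    and "(\<integral>x. (rfm_basis \<sigma> \<psi> S m j x)\<^sup>2 \<partial>lebesgue_on \<Omega>) \<le> b\<^sup>2 * measure lebesgue (dilated_subdomain \<rho> S m)"
proof -
  let ?D = "dilated_subdomain \<rho> S m"
  interpret finite_measure "lebesgue_on \<Omega>"
    by (rule finite_measure_lebesgue_on[OF lmeasurable_domain])
  have sq: "(rfm_basis \<sigma> \<psi> S m j x)\<^sup>2 \<le> b\<^sup>2 * indicator ?D x" for x
  proof -
    have "\<bar>rfm_basis \<sigma> \<psi> S m j x\<bar>\<^sup>2 \<le> (b * indicator ?D x)\<^sup>2"
      using bound[OF assms] by (intro power_mono) auto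
    then show ?thesis by (simp add: power_mult_distrib power2_eq_square[of "indicator _ _"] flip: indicator_inter_arith)
  qed
  have D: "?D \<inter> \<Omega> \<in> sets lebesgue"
    using lmeasurable_domain by (intro sets.Int) (auto intro: fmeasurableD)
  have [measurable]: "(indicator ?D :: _ \<Rightarrow> real) \<in> borel_measurable (lebesgue_on \<Omega>)"
    by (intro measurable_restrict_space1 borel_measurable_indicator) simp
  have ind: "integrable (lebesgue_on \<Omega>) (\<lambda>x. b\<^sup>2 * indicator ?D x)"
    by (intro integrable_mult_right integrable_const_bound[of _ 1])
      (auto simp: indicator_le_1)
  show int: "integrable (lebesgue_on \<Omega>) (\<lambda>x. (rfm_basis \<sigma> \<psi> S m j x)\<^sup>2)"
    using rfm_basis_measurable_on
    by (intro Bochner_Integration.integrable_bound[OF ind]) (auto simp: order_trans[OF sq])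
  have "(\<integral>x. (rfm_basis \<sigma> \<psi> S m j x)\<^sup>2 \<partial>lebesgue_on \<Omega>) \<le> (\<integral>x. b\<^sup>2 * indicator ?D x \<partial>lebesgue_on \<Omega>)"
    by (intro integral_mono int ind sq)
  also have "\<dots> = b\<^sup>2 * measure (lebesgue_on \<Omega>) (?D \<inter> \<Omega>)"
    by simp
  also have "measure (lebesgue_on \<Omega>) (?D \<inter> \<Omega>) = measure lebesgue (?D \<inter> \<Omega>)"
    using lmeasurable_domain by (subst measure_restrict_space) (auto intro: fmeasurableD)
  also have "b\<^sup>2 * \<dots> \<le> b\<^sup>2 * measure lebesgue ?D"
    using D by (intro mult_left_mono measure_mono_fmeasurable) auto
  finally show "(\<integral>x. (rfm_basis \<sigma> \<psi> S m j x)\<^sup>2 \<partial>lebesgue_on \<Omega>) \<le> b\<^sup>2 * measure lebesgue ?D" .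
qed

lemma in_L2_rfm_fun:
  assumes "rfm_space_on (cbox lo hi) R S"
  shows "in_L2 \<Omega> (rfm_fun \<sigma> \<psi> S w)"
  unfolding in_L2_def
proof
  note [measurable] = rfm_basis_measurable_on
  show "rfm_fun \<sigma> \<psi> S w \<in> borel_measurable (lebesgue_on \<Omega>)"
    by (subst borel_measurable_euclidean_space) (auto simp: rfm_fun_def Basis_vec_def inner_axis)
  \<comment> \<open>The double sum is read as a single sum over pairs \<open>(m, j)\<close>, so that
    \<open>square_integrable_sum\<close> applies.\<close>
  have "integrable (lebesgue_on \<Omega>)
      (\<lambda>x. (\<Sum>(m, j)\<in>{..<rfm_M S} \<times> {..<rfm_J S}. w k m j * rfm_basis \<sigma> \<psi> S m j x)\<^sup>2)" for k
    using square_integrable_sum[of "{..<rfm_M S} \<times> {..<rfm_J S}" "\<lambda>(m, j). rfm_basis \<sigma> \<psi> S m j"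
        "lebesgue_on \<Omega>" "\<lambda>(m, j). w k m j"] rfm_basis_square(1)[OF assms]
    by (auto simp: case_prod_beta rfm_basis_measurable_on)
  then show "integrable (lebesgue_on \<Omega>) (\<lambda>x. (norm (rfm_fun \<sigma> \<psi> S w x))\<^sup>2)"
    unfolding rfm_fun_square by (simp add: sum.cartesian_product)
qed

text \<open>The integrand is jointly measurable in \<omega> and \<open>x\<close>, and the domain has
  finite measure, so integrating out \<open>x\<close> preserves measurability. This is needed for
  the error to be a genuine random variable with an expectation.\<close>

lemma L2_norm_rfm_fun_measurable:
  fixes f :: "('d, 'u::finite) field" and W :: "'w \<Rightarrow> 'u coefs"
  assumes W: "\<And>k m j. m < rfm_M S \<Longrightarrow> j < rfm_J S \<Longrightarrow> (\<lambda>\<omega>. W \<omega> k m j) \<in> borel_measurable P"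
    and f: "f \<in> borel_measurable (lebesgue_on \<Omega>)"
  shows "(\<lambda>\<omega>. L2_norm \<Omega> (\<lambda>x. rfm_fun \<sigma> \<psi> S (W \<omega>) x - f x)) \<in> borel_measurable P"
proof -
  interpret finite_measure "lebesgue_on \<Omega>"
    by (rule finite_measure_lebesgue_on[OF lmeasurable_domain])
  note [measurable] = f
  note [measurable] = rfm_basis_measurable_on W
  have "(\<lambda>(\<omega>, x). (norm (rfm_fun \<sigma> \<psi> S (W \<omega>) x - f x))\<^sup>2)
      \<in> borel_measurable (P \<Otimes>\<^sub>M lebesgue_on \<Omega>)"
    unfolding norm_vec_square rfm_fun_def by simp
  then have "(\<lambda>\<omega>. \<integral>x. (norm (rfm_fun \<sigma> \<psi> S (W \<omega>) x - f x))\<^sup>2 \<partial>lebesgue_on \<Omega>) \<in> borel_measurable P"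
    by (rule borel_measurable_lebesgue_integral)
  then show ?thesis unfolding L2_norm_def by measurable
qed

text \<open>The estimate is phrased through an integrable majorant \<open>Z\<close> of the random
  norm, to which deterministic errors can be added before taking expectations. The summand 1 in
  \<open>s\<close> makes \<open>s\<close> positive even for a bounding box of volume zero, so that
  division by \<open>s\<close> is legitimate.\<close>

lemma rfm_perturbation_bound:
  fixes S :: "'d rfm_space" and Ut :: "'u::finite coefs" and P :: "'w measure"
  assumes S: "rfm_space_on (cbox lo hi) R S" and P: "prob_space P" and "\<delta> > 0"
    and pert: "perturbed_coefs P S \<mu> \<delta> \<beta> du Ut Uh"
  defines "s \<equiv> (b * sqrt (\<rho> ^ CARD('d) * measure lebesgue (cbox lo hi)) + 1)
                  * sqrt (real (CARD('u) * rfm_M S * rfm_J S)) * \<delta>"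
  shows "\<exists>Z. integrable P Z \<and> (\<integral>\<omega>. Z \<omega> \<partial>P) \<le> s \<and>
    (\<forall>\<omega>\<in>space P. L2_norm \<Omega> (\<lambda>x. rfm_fun \<sigma> \<psi> S (Uh \<omega>) x - rfm_fun \<sigma> \<psi> S Ut x) \<le> Z \<omega>)"
proof -
  interpret prob_space P by (rule P)
  let ?M = "rfm_M S" and ?J = "rfm_J S" and ?N = "lebesgue_on \<Omega>"
  define h where "h m j = rfm_basis \<sigma> \<psi> S m j" for m j
  \<comment> \<open>This is the total volume of the dilated subdomains, by
    \<open>measure_dilated_subdomains\<close>.\<close>
  define A where "A = \<rho> ^ CARD('d) * measure lebesgue (cbox lo hi)"
  define c where "c k m \<omega> i = (\<Sum>l<?J. du k m l \<omega> * \<beta> k m l i)" for k m \<omega> i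
  define Y where "Y k m \<omega> = (\<integral>x. (\<Sum>i<?J. c k m \<omega> i * h m i x)\<^sup>2 \<partial>?N)" for k m \<omega>
  \<comment> \<open>A majorant of the squared norm of the perturbation; the factor \<open>M\<close>
    comes from Cauchy-Schwarz over the subdomains.\<close>
  define V where "V \<omega> = (\<Sum>k\<in>UNIV. (\<Sum>m<?M. Y k m \<omega>) * real ?M)" for \<omega>
  have MJ: "?M \<ge> 1" "?J \<ge> 1" using S by (auto simp: rfm_space_on_def)
  have "A \<ge> 0" using \<rho> by (simp add: A_def)
  have "s > 0" using MJ b \<open>\<delta> > 0\<close> \<open>A \<ge> 0\<close> unfolding s_def A_def[symmetric]
    by (intro mult_pos_pos add_nonneg_pos) auto
  have hmeas: "h m i \<in> borel_measurable ?N" for m i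
    using rfm_basis_measurable_on by (simp add: h_def)
  have h2: "integrable ?N (\<lambda>x. (h m i x)\<^sup>2)" "(\<integral>x. (h m i x)\<^sup>2 \<partial>?N) \<le> b\<^sup>2 * measure lebesgue (dilated_subdomain \<rho> S m)"
    if "m < ?M" "i < ?J" for m i
    using rfm_basis_square[OF S that] by (auto simp: h_def)
  have Y: "integrable P (Y k m)"
    "(\<integral>\<omega>. Y k m \<omega> \<partial>P) \<le> \<delta>\<^sup>2 * (real ?J * (b\<^sup>2 * measure lebesgue (dilated_subdomain \<rho> S m)))"
    if "m < ?M" for k m
  proof -
    have iid: "iid_perturbation P ?J (du k m) \<mu> \<delta>" and ob: "orthonormal_basis ?J (\<beta> k m)"
      using pert that by (auto simp: perturbed_coefs_def)
    note ms = iid_perturbation_mean_square[OF P iid ob hmeas h2(1)[OF that], of "\<lambda>i. i", folded c_def, folded Y_def]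
    show "integrable P (Y k m)" using ms(1) by simp
    have "(\<integral>\<omega>. Y k m \<omega> \<partial>P) \<le> \<delta>\<^sup>2 * (\<Sum>i<?J. \<integral>x. (h m i x)\<^sup>2 \<partial>?N)"
      using ms(2) by simp
    also have "\<dots> \<le> \<delta>\<^sup>2 * (\<Sum>i<?J. b\<^sup>2 * measure lebesgue (dilated_subdomain \<rho> S m))"
      using h2(2)[OF that] by (intro mult_left_mono sum_mono) auto
    finally show "(\<integral>\<omega>. Y k m \<omega> \<partial>P) \<le> \<delta>\<^sup>2 * (real ?J * (b\<^sup>2 * measure lebesgue (dilated_subdomain \<rho> S m)))"
      by simp
  qed
  have V_int: "integrable P V"
    unfolding V_def using Y(1) by (intro integral_double_sum) auto
  have "(\<integral>\<omega>. V \<omega> \<partial>P) = (\<Sum>k\<in>(UNIV::'u set). (\<Sum>m<?M. \<integral>\<omega>. Y k m \<omega> \<partial>P) * real ?M)"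
    unfolding V_def using Y(1) by (intro integral_double_sum) auto
  also have "\<dots> \<le> (\<Sum>k\<in>(UNIV::'u set).
      (\<Sum>m<?M. \<delta>\<^sup>2 * (real ?J * (b\<^sup>2 * measure lebesgue (dilated_subdomain \<rho> S m)))) * real ?M)"
    using Y(2) by (intro sum_mono mult_right_mono) auto
  \<comment> \<open>The volumes add up to \<open>A\<close>, so only one factor \<open>M\<close>
    remains, the one from Cauchy-Schwarz.\<close>
  also have "\<dots> = real (CARD('u) * ?M * ?J) * \<delta>\<^sup>2 * (b\<^sup>2 * A)"
    unfolding A_def measure_dilated_subdomains[OF S \<rho>, symmetric]
    by (simp add: sum_distrib_left mult_ac)
  also have "\<dots> \<le> real (CARD('u) * ?M * ?J) * \<delta>\<^sup>2 * (b * sqrt A + 1)\<^sup>2"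
  proof -
    have "b\<^sup>2 * A = (b * sqrt A)\<^sup>2" using \<open>A \<ge> 0\<close> by (simp add: power_mult_distrib)
    also have "\<dots> \<le> (b * sqrt A + 1)\<^sup>2" using b \<open>A \<ge> 0\<close> by (intro power_mono) auto
    finally show ?thesis by (intro mult_left_mono) auto
  qed
  also have "\<dots> = s\<^sup>2" unfolding s_def A_def[symmetric] by (simp add: power_mult_distrib)
  finally have EV: "(\<integral>\<omega>. V \<omega> \<partial>P) \<le> s\<^sup>2" .
  \<comment> \<open>By AM-GM, \<open>n \<le> (n\<^sup>2 / s + s) / 2\<close>, so the mean-square bound \<open>s\<^sup>2\<close> gives the mean bound \<open>s\<close>.\<close>
  show ?thesis
  proof (intro exI[of _ "\<lambda>\<omega>. (V \<omega> / s + s) / 2"] conjI ballI)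
    show "integrable P (\<lambda>\<omega>. (V \<omega> / s + s) / 2)" using V_int by simp
    have "(\<integral>\<omega>. (V \<omega> / s + s) / 2 \<partial>P) = ((\<integral>\<omega>. V \<omega> \<partial>P) / s + s) / 2"
      using V_int prob_space by simp
    also have "\<dots> \<le> (s\<^sup>2 / s + s) / 2" using EV \<open>s > 0\<close> by (simp add: divide_right_mono)
    also have "\<dots> = s" using \<open>s > 0\<close> by (simp add: power2_eq_square)
    finally show "(\<integral>\<omega>. (V \<omega> / s + s) / 2 \<partial>P) \<le> s" .
  next
    fix \<omega> assume \<omega>: "\<omega> \<in> space P"
    let ?n = "L2_norm \<Omega> (\<lambda>x. rfm_fun \<sigma> \<psi> S (Uh \<omega>) x - rfm_fun \<sigma> \<psi> S Ut x)"
    have d: "(norm (rfm_fun \<sigma> \<psi> S (Uh \<omega>) x - rfm_fun \<sigma> \<psi> S Ut x))\<^sup>2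
        = (\<Sum>k\<in>UNIV. (\<Sum>m<?M. \<Sum>i<?J. c k m \<omega> i * h m i x)\<^sup>2)" for x
      unfolding rfm_fun_diff rfm_fun_square h_def c_def
      using pert \<omega> by (intro sum.cong refl arg_cong[of _ _ "\<lambda>t. t\<^sup>2"]) (simp add: perturbed_coefs_def)
    have int: "integrable ?N (\<lambda>x. (\<Sum>i<?J. c k m \<omega> i * h m i x)\<^sup>2)" if "m < ?M" for k m
      using hmeas h2(1)[OF that] by (intro square_integrable_sum) auto
    \<comment> \<open>Pointwise Cauchy-Schwarz over the subdomains. Perturbations of different
      subdomains may be correlated, so no cancellation between them is available.\<close>
    have "?n\<^sup>2 \<le> (\<integral>x. (\<Sum>k\<in>UNIV. (\<Sum>m<?M. (\<Sum>i<?J. c k m \<omega> i * h m i x)\<^sup>2) * real ?M) \<partial>?N)"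
      unfolding L2_norm_square
    proof (rule integral_mono)
      show "integrable ?N (\<lambda>x. (norm (rfm_fun \<sigma> \<psi> S (Uh \<omega>) x - rfm_fun \<sigma> \<psi> S Ut x))\<^sup>2)"
        using in_L2_diff[OF in_L2_rfm_fun[OF S] in_L2_rfm_fun[OF S]] by (auto simp: in_L2_def)
      show "integrable ?N (\<lambda>x. \<Sum>k\<in>UNIV. (\<Sum>m<?M. (\<Sum>i<?J. c k m \<omega> i * h m i x)\<^sup>2) * real ?M)"
        using int by (intro integral_double_sum) auto
      show "(norm (rfm_fun \<sigma> \<psi> S (Uh \<omega>) x - rfm_fun \<sigma> \<psi> S Ut x))\<^sup>2
          \<le> (\<Sum>k\<in>UNIV. (\<Sum>m<?M. (\<Sum>i<?J. c k m \<omega> i * h m i x)\<^sup>2) * real ?M)" for x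
        unfolding d using sum_squared_le_sum_of_squares[of _ "{..<?M}"] by (intro sum_mono) auto
    qed
    also have "\<dots> = V \<omega>"
      unfolding V_def Y_def using int by (intro integral_double_sum) auto
    finally have "?n\<^sup>2 \<le> V \<omega>" .
    moreover have "2 * ?n * s \<le> ?n\<^sup>2 + s\<^sup>2"
      using zero_le_power2[of "?n - s"] by (simp add: power2_diff)
    ultimately show "?n \<le> (V \<omega> / s + s) / 2"
      using \<open>s > 0\<close> by (simp add: field_simps power2_eq_square)
  qed
qed

end

section \<open>The error estimate\<close>

text \<open>Each step amplifies the error by at most \<open>exp (L * dt)\<close> and adds
  \<open>c * dt\<close>. Starting from zero, \<open>n\<close> such contributions accumulate over the
  elapsed time \<open>n * dt\<close>.\<close>

lemma discrete_gronwall: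
  fixes e :: "nat \<Rightarrow> real"
  assumes "e 0 \<le> 0" and pos: "L \<ge> 0" "dt \<ge> 0" "c \<ge> 0"
    and step: "\<And>n. n < K \<Longrightarrow> e (Suc n) \<le> (1 + L * dt) * e n + c * dt"
  shows "n \<le> K \<Longrightarrow> e n \<le> c * (real n * dt) * exp (L * (real n * dt))"
proof (induction n)
  case 0
  then show ?case using assms by simp
next
  case (Suc n)
  let ?E = "exp (L * (real (Suc n) * dt))"
  have "e (Suc n) \<le> (1 + L * dt) * e n + c * dt" using step Suc.prems by simp
  also have "\<dots> \<le> exp (L * dt) * (c * (real n * dt) * exp (L * (real n * dt))) + c * dt"
  proof -
    have "(1 + L * dt) * e n \<le> (1 + L * dt) * (c * (real n * dt) * exp (L * (real n * dt)))"
      using Suc pos by (intro mult_left_mono) auto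
    also have "\<dots> \<le> exp (L * dt) * (c * (real n * dt) * exp (L * (real n * dt)))"
      using pos exp_ge_add_one_self[of "L * dt"] by (intro mult_right_mono) auto
    finally show ?thesis by simp
  qed
  also have "exp (L * dt) * (c * (real n * dt) * exp (L * (real n * dt))) = c * (real n * dt) * ?E"
    by (simp add: algebra_simps exp_add)
  \<comment> \<open>The new contribution is enlarged by the final exponential, which is at least 1,
    so that it combines with the earlier ones.\<close>
  also have "c * dt \<le> c * dt * ?E"
    using pos mult_left_mono[of 1 "?E" "c * dt"] by simp
  finally show ?case by (simp add: algebra_simps)
qed

theorem theorem3p4:
  fixes \<Omega> :: "(real ^ 'd::finite) set"
    and lo hi :: "real ^ 'd"
    and T R Llip Ctr :: real
    and pt :: nat
    and tab :: imex_tableau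
    and Lop Gop :: "('d, 'u::finite) field \<Rightarrow> ('d, 'u) field"
    and u0 :: "('d, 'u) field"
    and ue :: "real \<Rightarrow> ('d, 'u) field"
    and H :: "real \<Rightarrow> ('d, 'u) field \<Rightarrow> real \<Rightarrow> ('d, 'u) field"
    and \<sigma> \<psi> :: "real \<Rightarrow> real"
  assumes domain: "open \<Omega>" "connected \<Omega>" "bounded \<Omega>" "\<Omega> \<noteq> {}" "\<Omega> \<subseteq> cbox lo hi"
    and T: "T > 0"
    and operators: "linear_operator_on \<Omega> Lop" "operator_on \<Omega> Gop"
    and exact: "exact_solution \<Omega> T Lop Gop u0 ue"
    and features: "activation \<sigma>" "pou_profile \<psi>" "R > 0"
    and Llip: "Llip > 0"
  shows "\<exists>C\<^sub>2 > 0. \<exists>C\<^sub>3 > 0.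
    \<forall>(K::nat) (dt::real) (\<epsilon>::real) (\<mu>::real) (\<delta>::real)
     (S :: 'd rfm_space) (Q :: (real ^ 'd) set) (P :: 'w measure)
     (\<beta> :: nat \<Rightarrow> 'u \<Rightarrow> nat \<Rightarrow> nat \<Rightarrow> nat \<Rightarrow> real)
     (du :: nat \<Rightarrow> 'u \<Rightarrow> nat \<Rightarrow> nat \<Rightarrow> 'w \<Rightarrow> real)
     (Ut :: nat \<Rightarrow> 'u coefs) (Uh :: nat \<Rightarrow> 'w \<Rightarrow> 'u coefs)
     (u :: nat \<Rightarrow> ('d, 'u) field) (ut :: nat \<Rightarrow> ('d, 'u) field) (uh :: nat \<Rightarrow> 'w \<Rightarrow> ('d, 'u) field).
      dt > 0 \<and> real K * dt = T \<and>
      rfm_space_on (cbox lo hi) R S \<and> finite Q \<and> Q \<subseteq> \<Omega> \<and>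
      prob_space P \<and> \<mu> > 0 \<and> \<delta> > 0 \<and> \<epsilon> > 0 \<and>

      (\<forall>n\<le>K. imex_increment \<Omega> tab dt Lop Gop (u n) (H (real n * dt) (u n) dt) \<and>
              imex_increment \<Omega> tab dt Lop Gop (ue (real n * dt))
                (H (real n * dt) (ue (real n * dt)) dt) \<and>
              in_L2 \<Omega> (u n) \<and> in_L2 \<Omega> (ue (real n * dt)) \<and>
              in_L2 \<Omega> (H (real n * dt) (u n) dt) \<and>
              in_L2 \<Omega> (H (real n * dt) (ue (real n * dt)) dt)) \<and>
      (\<forall>x\<in>\<Omega>. u 0 x = u0 x) \<and>
      (\<forall>n<K. \<forall>x\<in>\<Omega>. u (Suc n) x = u n x + dt *\<^sub>R H (real n * dt) (u n) dt x) \<and>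

      (\<forall>n<K. optimal_rfm_step \<sigma> \<psi> S Q tab dt Lop Gop (ut n) (Ut (Suc n))) \<and>
      (\<forall>n\<in>{1..K}. \<forall>x\<in>\<Omega>. ut n x = rfm_fun \<sigma> \<psi> S (Ut n) x) \<and>
      (\<forall>n\<in>{1..K}. perturbed_coefs P S \<mu> \<delta> (\<beta> n) (du n) (Ut n) (Uh n)) \<and>
      (\<forall>n\<in>{1..K}. \<forall>\<omega>\<in>space P. \<forall>x\<in>\<Omega>. uh n \<omega> x = rfm_fun \<sigma> \<psi> S (Uh n \<omega>) x) \<and>
      (\<forall>\<omega>\<in>space P. \<forall>x\<in>\<Omega>. uh 0 \<omega> x = ue 0 x) \<and>

      (\<forall>n\<le>K. L2_norm \<Omega> (\<lambda>x. H (real n * dt) (u n) dt x - H (real n * dt) (ue (real n * dt)) dt x)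
              \<le> Llip * L2_norm \<Omega> (\<lambda>x. u n x - ue (real n * dt) x)) \<and>
      (\<forall>n\<le>K. in_L2 \<Omega> (ut n) \<and>
              L2_norm \<Omega> (\<lambda>x. ut n x - u n x) \<le> sqrt (real CARD('u)) * \<epsilon>) \<and>
      (\<forall>n<K. L2_norm \<Omega> (\<lambda>x. ue (real (Suc n) * dt) x - ue (real n * dt) x
                              - dt *\<^sub>R H (real n * dt) (ue (real n * dt)) dt x)
              \<le> Ctr * dt ^ (pt + 1))
      \<longrightarrow>
      (\<forall>n\<le>K. integrable P (\<lambda>\<omega>. L2_norm \<Omega> (\<lambda>x. uh n \<omega> x - ue (real n * dt) x)) \<and>
              (\<integral>\<omega>. L2_norm \<Omega> (\<lambda>x. uh n \<omega> x - ue (real n * dt) x) \<partial>P)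
                \<le> C\<^sub>2 * sqrt (real (CARD('u) * rfm_M S * rfm_J S)) * \<delta>
                  + sqrt (real CARD('u)) * \<epsilon> + C\<^sub>3 * dt ^ pt)"
proof -
  obtain b \<rho> where b: "b > 0" and \<rho>: "\<rho> > 0" and bound:
    "\<And>(S :: 'd rfm_space) m j x. rfm_space_on (cbox lo hi) R S \<Longrightarrow> m < rfm_M S \<Longrightarrow>
       j < rfm_J S \<Longrightarrow> \<bar>rfm_basis \<sigma> \<psi> S m j x\<bar> \<le> b * indicator (dilated_subdomain \<rho> S m) x"
    using rfm_basis_bounded[where ?'d = 'd, OF features] by metis
  note rfm = domain(1,3) features(1,2) b \<rho> bound
  \<comment> \<open>Both constants are fixed before the discretisation: the first is the factor in
    \<open>rfm_perturbation_bound\<close>, the second is the Gronwall constant at the final time.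
    The absolute value covers a \<open>Ctr\<close> of any sign, and the summands 1 ensure
    positivity.\<close>
  let ?C2 = "b * sqrt (\<rho> ^ CARD('d) * measure lebesgue (cbox lo hi)) + 1"
  let ?C3 = "\<bar>Ctr\<bar> * T * exp (Llip * T) + 1"
  have C2: "?C2 > 0" using b \<rho> by (simp add: add_nonneg_pos)
  have C3: "?C3 > 0" using T by (simp add: add_nonneg_pos)
  show ?thesis
  proof (rule exI[of _ ?C2], rule conjI[OF C2], rule exI[of _ ?C3], rule conjI[OF C3],
      intro allI impI; (elim conjE)?)
    fix K n :: nat and dt \<epsilon> \<mu> \<delta> :: real and S :: "'d rfm_space" and Q :: "(real ^ 'd) set"
      and P :: "'w measure" and \<beta> du
      and Ut :: "nat \<Rightarrow> 'u coefs" and Uh :: "nat \<Rightarrow> 'w \<Rightarrow> 'u coefs"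
      and u :: "nat \<Rightarrow> ('d, 'u) field" and ut :: "nat \<Rightarrow> ('d, 'u) field"
      and uh :: "nat \<Rightarrow> 'w \<Rightarrow> ('d, 'u) field"
    assume dt: "dt > 0" "real K * dt = T"
      and S: "rfm_space_on (cbox lo hi) R S"
      and P: "prob_space P" and \<delta>: "\<delta> > 0" and \<epsilon>: "\<epsilon> > 0"
      and L2: "\<forall>n\<le>K. imex_increment \<Omega> tab dt Lop Gop (u n) (H (real n * dt) (u n) dt) \<and>
              imex_increment \<Omega> tab dt Lop Gop (ue (real n * dt))
                (H (real n * dt) (ue (real n * dt)) dt) \<and>
              in_L2 \<Omega> (u n) \<and> in_L2 \<Omega> (ue (real n * dt)) \<and>
              in_L2 \<Omega> (H (real n * dt) (u n) dt) \<and>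
              in_L2 \<Omega> (H (real n * dt) (ue (real n * dt)) dt)"
      and u0: "\<forall>x\<in>\<Omega>. u 0 x = u0 x"
      and u: "\<forall>n<K. \<forall>x\<in>\<Omega>. u (Suc n) x = u n x + dt *\<^sub>R H (real n * dt) (u n) dt x"
      and ut: "\<forall>n\<in>{1..K}. \<forall>x\<in>\<Omega>. ut n x = rfm_fun \<sigma> \<psi> S (Ut n) x"
      and pert: "\<forall>n\<in>{1..K}. perturbed_coefs P S \<mu> \<delta> (\<beta> n) (du n) (Ut n) (Uh n)"
      and uh: "\<forall>n\<in>{1..K}. \<forall>\<omega>\<in>space P. \<forall>x\<in>\<Omega>. uh n \<omega> x = rfm_fun \<sigma> \<psi> S (Uh n \<omega>) x"
      and uh0: "\<forall>\<omega>\<in>space P. \<forall>x\<in>\<Omega>. uh 0 \<omega> x = ue 0 x"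
      and lip: "\<forall>n\<le>K. L2_norm \<Omega> (\<lambda>x. H (real n * dt) (u n) dt x - H (real n * dt) (ue (real n * dt)) dt x)
              \<le> Llip * L2_norm \<Omega> (\<lambda>x. u n x - ue (real n * dt) x)"
      and approx: "\<forall>n\<le>K. in_L2 \<Omega> (ut n) \<and>
              L2_norm \<Omega> (\<lambda>x. ut n x - u n x) \<le> sqrt (real CARD('u)) * \<epsilon>"
      and trunc: "\<forall>n<K. L2_norm \<Omega> (\<lambda>x. ue (real (Suc n) * dt) x - ue (real n * dt) x
                              - dt *\<^sub>R H (real n * dt) (ue (real n * dt)) dt x)
              \<le> Ctr * dt ^ (pt + 1)"
      and n: "n \<le> K"
    interpret prob_space P by (rule P)
    define e where "e n = L2_norm \<Omega> (\<lambda>x. u n x - ue (real n * dt) x)" for n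
    have L2u: "in_L2 \<Omega> (u n)" "in_L2 \<Omega> (ue (real n * dt))" "in_L2 \<Omega> (H (real n * dt) (u n) dt)"
      "in_L2 \<Omega> (H (real n * dt) (ue (real n * dt)) dt)" if "n \<le> K" for n
      using L2 that by blast+
    \<comment> \<open>One factor \<open>dt\<close> is split off the truncation error to fit
      \<open>discrete_gronwall\<close> with \<open>c\<close> equal to
      \<open>\<bar>Ctr\<bar> * dt ^ pt\<close>; summation over the steps thus costs one
      order.\<close>
    have step: "e (Suc n) \<le> (1 + Llip * dt) * e n + \<bar>Ctr\<bar> * dt ^ pt * dt" if "n < K" for n
    proof -
      have K: "n \<le> K" "Suc n \<le> K" using that by auto
      let ?d = "\<lambda>x. u n x - ue (real n * dt) x"
      let ?h = "\<lambda>x. H (real n * dt) (u n) dt x - H (real n * dt) (ue (real n * dt)) dt x"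
      let ?r = "\<lambda>x. ue (real (Suc n) * dt) x - ue (real n * dt) x
                       - dt *\<^sub>R H (real n * dt) (ue (real n * dt)) dt x"
      note l2 = L2u[OF K(1)] L2u[OF K(2)]
      have d: "in_L2 \<Omega> ?d" and h: "in_L2 \<Omega> (\<lambda>x. dt *\<^sub>R ?h x)" and r: "in_L2 \<Omega> (\<lambda>x. (- 1) *\<^sub>R ?r x)"
        by (intro in_L2_diff in_L2_scaleR l2)+
      \<comment> \<open>The new error is the old error plus \<open>dt\<close> times the difference
        of the increments, minus the local truncation residual.\<close>
      have "e (Suc n) = L2_norm \<Omega> (\<lambda>x. ?d x + dt *\<^sub>R ?h x + (- 1) *\<^sub>R ?r x)"
        unfolding e_def using u that by (intro L2_norm_cong arg_cong[of _ _ norm]) (simp add: scaleR_diff_right)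
      also have "\<dots> \<le> e n + dt * L2_norm \<Omega> ?h + L2_norm \<Omega> ?r"
        using L2_norm_triangle[OF in_L2_add[OF d h] r] L2_norm_triangle[OF d h] dt
        unfolding L2_norm_scaleR e_def by simp
      also have "\<dots> \<le> e n + dt * (Llip * e n) + \<bar>Ctr\<bar> * dt ^ (pt + 1)"
      proof (intro add_mono mult_left_mono order_refl)
        have "Ctr * dt ^ (pt + 1) \<le> \<bar>Ctr\<bar> * dt ^ (pt + 1)" using dt by (intro mult_right_mono) auto
        then show "L2_norm \<Omega> ?r \<le> \<bar>Ctr\<bar> * dt ^ (pt + 1)" using trunc that by fastforce
      qed (use lip K dt in \<open>auto simp: e_def\<close>)
      finally show ?thesis by (simp add: algebra_simps)
    qed
    have e: "e n \<le> ?C3 * dt ^ pt"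
    proof -
      have "u 0 x - ue (real 0 * dt) x = 0" if "x \<in> \<Omega>" for x
        using exact u0 that by (simp add: exact_solution_def)
      then have "e 0 = L2_norm \<Omega> (\<lambda>x. 0 :: real ^ 'u)"
        unfolding e_def by (intro L2_norm_cong) (simp only: norm_zero)
      then have "e 0 \<le> 0" by (simp add: L2_norm_def)
      then have "e n \<le> \<bar>Ctr\<bar> * dt ^ pt * (real n * dt) * exp (Llip * (real n * dt))"
        using Llip dt step n by (intro discrete_gronwall[where K = K]) auto
      \<comment> \<open>Since \<open>n * dt\<close> is at most \<open>K * dt = T\<close>, the bound
        becomes uniform in \<open>n\<close>.\<close>
      also have "\<dots> \<le> \<bar>Ctr\<bar> * dt ^ pt * T * exp (Llip * T)"
      proof -
        have "real n * dt \<le> T" using n dt by (auto simp flip: dt(2) intro: mult_right_mono)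
        then show ?thesis using Llip dt T by (intro mult_mono) (auto intro: mult_left_mono)
      qed
      also have "\<dots> \<le> ?C3 * dt ^ pt" using dt by (simp add: algebra_simps)
      finally show ?thesis .
    qed
    let ?s = "?C2 * sqrt (real (CARD('u) * rfm_M S * rfm_J S)) * \<delta>"
    let ?t = "sqrt (real CARD('u)) * \<epsilon> + ?C3 * dt ^ pt"
    let ?err = "\<lambda>\<omega>. L2_norm \<Omega> (\<lambda>x. uh n \<omega> x - ue (real n * dt) x)"
    have nonneg: "?s \<ge> 0" "?t \<ge> 0" using C2 C3 \<delta> \<epsilon> dt by (auto intro!: add_nonneg_nonneg)
    \<comment> \<open>A pathwise integrable majorant together with measurability of the error gives
      both integrability and the bound on the expectation.\<close>
    obtain Z where Z: "integrable P Z" "(\<integral>\<omega>. Z \<omega> \<partial>P) \<le> ?s + ?t"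
      "\<And>\<omega>. \<omega> \<in> space P \<Longrightarrow> ?err \<omega> \<le> Z \<omega>" and meas: "?err \<in> borel_measurable P"
    \<comment> \<open>The random feature representation and the perturbation model start at step 1.
      At step 0 the numerical state equals the exact one on \<open>space P\<close>, so the error
      vanishes there.\<close>
    proof (cases "n = 0")
      case True
      have err: "?err \<omega> = 0" if "\<omega> \<in> space P" for \<omega>
      proof -
        have "?err \<omega> = L2_norm \<Omega> (\<lambda>x. 0 :: real ^ 'u)"
          using uh0 that True by (intro L2_norm_cong) simp
        then show ?thesis by (simp add: L2_norm_def)
      qed
      have "?err \<in> borel_measurable P \<longleftrightarrow> (\<lambda>_. 0 :: real) \<in> borel_measurable P"
        by (rule measurable_cong[OF err])
      then have "?err \<in> borel_measurable P" by simp
      then show ?thesis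
        by (rule that[of "\<lambda>_. 0", rotated 3]) (simp_all only: err order_refl integrable_zero
            Bochner_Integration.integral_zero add_nonneg_nonneg[OF nonneg])
    next
      case False
      then have n1: "n \<in> {1..K}" using n by simp
      have pn: "perturbed_coefs P S \<mu> \<delta> (\<beta> n) (du n) (Ut n) (Uh n)" using pert n1 by blast
      obtain Y where Y: "integrable P Y" "(\<integral>\<omega>. Y \<omega> \<partial>P) \<le> ?s"
        "\<And>\<omega>. \<omega> \<in> space P \<Longrightarrow>
          L2_norm \<Omega> (\<lambda>x. rfm_fun \<sigma> \<psi> S (Uh n \<omega>) x - rfm_fun \<sigma> \<psi> S (Ut n) x) \<le> Y \<omega>"
        using rfm_perturbation_bound[OF rfm S P \<delta> pn] by blast
      have err: "?err \<omega> = L2_norm \<Omega> (\<lambda>x. rfm_fun \<sigma> \<psi> S (Uh n \<omega>) x - ue (real n * dt) x)"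
        if "\<omega> \<in> space P" for \<omega>
        using uh n1 that by (intro L2_norm_cong) simp
      \<comment> \<open>On \<open>space P\<close> the numerical coefficients are the optimal ones
        plus finite linear combinations of the perturbation variables, and inherit their
        measurability.\<close>
      have "(\<lambda>\<omega>. Uh n \<omega> k m j) \<in> borel_measurable P" if "m < rfm_M S" "j < rfm_J S" for k m j
      proof -
        have [measurable]: "du n k m l \<in> borel_measurable P" if "l < rfm_J S" for l
          using pn \<open>m < rfm_M S\<close> that by (auto simp: perturbed_coefs_def iid_perturbation_def integrable_iff_bounded)
        have "Uh n \<omega> k m j = Ut n k m j + (\<Sum>l<rfm_J S. du n k m l \<omega> * \<beta> n k m l j)"
          if "\<omega> \<in> space P" for \<omega>
          using pn that \<open>m < rfm_M S\<close> \<open>j < rfm_J S\<close> unfolding perturbed_coefs_def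
          by (metis add.commute diff_add_cancel)
        then have "(\<lambda>\<omega>. Uh n \<omega> k m j) \<in> borel_measurable P \<longleftrightarrow>
            (\<lambda>\<omega>. Ut n k m j + (\<Sum>l<rfm_J S. du n k m l \<omega> * \<beta> n k m l j)) \<in> borel_measurable P"
          by (intro measurable_cong)
        then show ?thesis by simp
      qed
      then have "(\<lambda>\<omega>. L2_norm \<Omega> (\<lambda>x. rfm_fun \<sigma> \<psi> S (Uh n \<omega>) x - ue (real n * dt) x)) \<in> borel_measurable P"
        using L2u(2)[OF n] by (intro L2_norm_rfm_fun_measurable[OF rfm]) (auto simp: in_L2_def)
      then have meas: "?err \<in> borel_measurable P"
        by (subst measurable_cong[OF err])
      have "?err \<omega> \<le> Y \<omega> + ?t" if "\<omega> \<in> space P" for \<omega>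
      proof -
        let ?a = "\<lambda>x. rfm_fun \<sigma> \<psi> S (Uh n \<omega>) x - rfm_fun \<sigma> \<psi> S (Ut n) x"
        let ?b = "\<lambda>x. ut n x - u n x"
        let ?c = "\<lambda>x. u n x - ue (real n * dt) x"
        have l2: "in_L2 \<Omega> ?a" "in_L2 \<Omega> ?b" "in_L2 \<Omega> ?c"
          using approx n by (auto intro!: in_L2_diff in_L2_rfm_fun[OF rfm S] L2u)
        \<comment> \<open>The error telescopes through the optimal solution and the time-discrete
          solution. Only the first summand is random; the other two have deterministic
          bounds.\<close>
        have "?err \<omega> = L2_norm \<Omega> (\<lambda>x. ?a x + ?b x + ?c x)"
          unfolding err[OF that] using ut n1 by (intro L2_norm_cong) simp
        also have "\<dots> \<le> L2_norm \<Omega> ?a + L2_norm \<Omega> ?b + L2_norm \<Omega> ?c"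
          using L2_norm_triangle[OF in_L2_add[OF l2(1,2)] l2(3)] L2_norm_triangle[OF l2(1,2)] by simp
        also have "\<dots> \<le> Y \<omega> + sqrt (real CARD('u)) * \<epsilon> + ?C3 * dt ^ pt"
          using Y(3)[OF that] approx n e unfolding e_def by (intro add_mono) auto
        finally show ?thesis by simp
      qed
      moreover have "(\<integral>\<omega>. Y \<omega> + ?t \<partial>P) \<le> ?s + ?t"
        using Y(1,2) prob_space by simp
      ultimately show ?thesis using Y(1) meas by (intro that[of "\<lambda>\<omega>. Y \<omega> + ?t"]) auto
    qed
    \<comment> \<open>The error is nonnegative and lies below \<open>Z\<close>, hence below the
      absolute value of \<open>Z\<close>.\<close>
    have int: "integrable P ?err"
      using Z meas by (intro Bochner_Integration.integrable_bound[OF Z(1)] AE_I2)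
        (auto intro: order_trans[OF Z(3) abs_ge_self])
    have "(\<integral>\<omega>. ?err \<omega> \<partial>P) \<le> (\<integral>\<omega>. Z \<omega> \<partial>P)"
      using Z int by (intro integral_mono) auto
    with int Z(2) show "integrable P ?err \<and>
        (\<integral>\<omega>. ?err \<omega> \<partial>P) \<le> ?s + sqrt (real CARD('u)) * \<epsilon> + ?C3 * dt ^ pt"
      by simp
  qed
qed

end
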